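(* Let $n$ be an even positive integer and $G$ a connected graph on $n$ vertices with minimum degree $\delta(G)\geqslant 2$. Then: (i) if $n=6$ and $\rho(G)\geqslant\rho(K_2\vee(K_2\cup 2K_1))$, then $G$ is $1$-excludable unless $G\cong K_2\vee(K_2\cup 2K_1)$; (ii) if $n=8$ and $\rho(G)\geqslant\rho(K_3\vee(K_2\cup 3K_1))$, then $G$ is $1$-excludable unless $G\cong K_3\vee(K_2\cup 3K_1)$; (iii) if $n\geqslant 10$ and $\rho(G)\geqslant\rho(K_1\vee(K_2\cup K_{n-3}))$, then $G$ is $1$-excludable unless $G\cong K_1\vee(K_2\cup K_{n-3})$.
   Context: All graphs are finite, simple and undirected. $\rho(G)$ denotes the spectral radius (largest eigenvalue) of the adjacency matrix of $G$. A graph $G$ is $1$-excludable if for every edge $e$ of $G$ there is a perfect matching of $G$ not containing $e$. $K_r$ is the complete graph on $r$ vertices; $tK_1$ is the edgeless graph on $t$ vertices; $G_1\cup G_2$ is the disjoint union; the join $G_1\vee G_2$ is obtained from $G_1\cup G_2$ by adding all edges between $V(G_1)$ and $V(G_2)$. *)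

theory Defs
  imports
    "Graph_Theory.Pair_Digraph"
    "Graph_Theory.Digraph_Isomorphism"
    "Jordan_Normal_Form.Spectral_Radius"
begin

text \<open>
  A finite simple undirected graph is a \<^typ>\<open>'a pair_pre_digraph\<close> satisfying
  \<^locale>\<open>pair_graph\<close>: finite, loop-free, and symmetric. An undirected edge \<open>{u, v}\<close> is
  therefore represented by the two arcs \<open>(u, v)\<close> and \<open>(v, u)\<close>.
\<close>

definition uedges :: "'a pair_pre_digraph \<Rightarrow> 'a set set" where
  "uedges G = {{u, v} | u v. (u, v) \<in> parcs G}"

text \<open>For a symmetric digraph the out-degree is the degree of the undirected graph.\<close>

definition min_degree :: "'a pair_pre_digraph \<Rightarrow> nat" where
  "min_degree G = Min (out_degree (with_proj G) ` pverts G)"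

definition perfect_matching :: "'a pair_pre_digraph \<Rightarrow> 'a set set \<Rightarrow> bool" where
  "perfect_matching G M \<longleftrightarrow> M \<subseteq> uedges G \<and> (\<forall>v \<in> pverts G. \<exists>!e. e \<in> M \<and> v \<in> e)"

definition one_excludable :: "'a pair_pre_digraph \<Rightarrow> bool" where
  "one_excludable G \<longleftrightarrow> (\<forall>e \<in> uedges G. \<exists>M. perfect_matching G M \<and> e \<notin> M)"

abbreviation graph_iso :: "'a pair_pre_digraph \<Rightarrow> 'b pair_pre_digraph \<Rightarrow> bool" (infix \<open>\<cong>\<^sub>g\<close> 50) where
  "G \<cong>\<^sub>g H \<equiv> digraph_iso (with_proj G) (with_proj H)"

definition complete_graph :: "nat \<Rightarrow> nat pair_pre_digraph" where
  "complete_graph r = \<lparr> pverts = {..<r}, parcs = {(i, j). i < r \<and> j < r \<and> i \<noteq> j} \<rparr>"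

definition edgeless_graph :: "nat \<Rightarrow> nat pair_pre_digraph" where
  "edgeless_graph t = \<lparr> pverts = {..<t}, parcs = {} \<rparr>"

definition disjoint_union ::
  "'a pair_pre_digraph \<Rightarrow> 'b pair_pre_digraph \<Rightarrow> ('a + 'b) pair_pre_digraph" (infixl \<open>\<union>\<^sub>g\<close> 65) where
  "G \<union>\<^sub>g H = \<lparr> pverts = pverts G <+> pverts H,
               parcs = map_prod Inl Inl ` parcs G \<union> map_prod Inr Inr ` parcs H \<rparr>"

definition graph_join ::
  "'a pair_pre_digraph \<Rightarrow> 'b pair_pre_digraph \<Rightarrow> ('a + 'b) pair_pre_digraph" (infixl \<open>\<or>\<^sub>g\<close> 60) where
  "G \<or>\<^sub>g H = \<lparr> pverts = pverts (G \<union>\<^sub>g H),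
               parcs = parcs (G \<union>\<^sub>g H)
                 \<union> (Inl ` pverts G) \<times> (Inr ` pverts H) \<union> (Inr ` pverts H) \<times> (Inl ` pverts G) \<rparr>"

text \<open>
  Matrices are indexed by initial segments of the naturals, so the adjacency matrix depends on an
  enumeration of the vertices; its spectrum does not (\<open>spectrum_adjacency_matrix_cong\<close>).
\<close>

definition adjacency_matrix :: "'a list \<Rightarrow> 'a pair_pre_digraph \<Rightarrow> real mat" where
  "adjacency_matrix vs G =
     mat (length vs) (length vs) (\<lambda>(i, j). if (vs ! i, vs ! j) \<in> parcs G then 1 else 0)"

definition vertex_enum :: "'a pair_pre_digraph \<Rightarrow> 'a list" where
  "vertex_enum G = (SOME vs. distinct vs \<and> set vs = pverts G)"

definition graph_spectral_radius :: "'a pair_pre_digraph \<Rightarrow> real" (\<open>\<rho>\<close>) where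
  "\<rho> G = Max (spectrum (adjacency_matrix (vertex_enum G) G))"

lemma vertex_enum:
  assumes "finite (pverts G)"
  shows "distinct (vertex_enum G)" "set (vertex_enum G) = pverts G"
proof -
  have "\<exists>vs. distinct vs \<and> set vs = pverts G"
    using finite_distinct_list[OF assms] by auto
  then have "distinct (vertex_enum G) \<and> set (vertex_enum G) = pverts G"
    unfolding vertex_enum_def by (rule someI_ex)
  then show "distinct (vertex_enum G)" "set (vertex_enum G) = pverts G" by auto
qed

lemma pair_graph_complete_graph: "pair_graph (complete_graph r)"
proof -
  have "parcs (complete_graph r) \<subseteq> {..<r} \<times> {..<r}"
    by (auto simp: complete_graph_def)
  then have "finite (parcs (complete_graph r))" by (rule finite_subset) auto
  then show ?thesis
    by unfold_locales (auto simp: complete_graph_def symmetric_def intro!: symI)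
qed

lemma pair_graph_edgeless_graph: "pair_graph (edgeless_graph t)"
  by unfold_locales (auto simp: edgeless_graph_def symmetric_def intro!: symI)

lemma pair_graph_disjoint_union:
  assumes "pair_graph G" "pair_graph H"
  shows "pair_graph (G \<union>\<^sub>g H)"
proof -
  interpret G: pair_graph G by fact
  interpret H: pair_graph H by fact
  have "sym (parcs G)" "sym (parcs H)"
    using G.pair_sym_arcs H.pair_sym_arcs by (simp_all add: symmetric_def)
  then have "sym (parcs (G \<union>\<^sub>g H))"
    by (fastforce simp: disjoint_union_def intro!: symI dest: symD)
  then show ?thesis
    by unfold_locales
      (auto simp: disjoint_union_def symmetric_def
        G.pair_finite_verts H.pair_finite_verts G.pair_finite_arcs H.pair_finite_arcs
        dest: G.in_arcsD1 G.in_arcsD2 H.in_arcsD1 H.in_arcsD2 G.pair_no_loops H.pair_no_loops)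
qed

lemma pair_graph_join:
  assumes "pair_graph G" "pair_graph H"
  shows "pair_graph (G \<or>\<^sub>g H)"
proof -
  interpret G: pair_graph G by fact
  interpret H: pair_graph H by fact
  interpret U: pair_graph "G \<union>\<^sub>g H" by (rule pair_graph_disjoint_union[OF assms])
  have "sym (parcs (G \<union>\<^sub>g H))" using U.pair_sym_arcs by (simp add: symmetric_def)
  moreover have "pverts (G \<union>\<^sub>g H) = pverts G <+> pverts H" by (simp add: disjoint_union_def)
  ultimately show ?thesis
    by unfold_locales
      (auto simp: graph_join_def symmetric_def sym_def U.pair_finite_arcs
        G.pair_finite_verts H.pair_finite_verts
        dest: U.in_arcsD1 U.in_arcsD2 U.pair_no_loops)
qed

lemma nonzero_vec_entry:
  assumes "x \<in> carrier_vec m" "x \<noteq> 0\<^sub>v m"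
  obtains i where "i < m" "x $ i \<noteq> 0"
proof -
  have "\<exists>i<m. x $ i \<noteq> 0"
  proof (rule ccontr)
    assume "\<not> ?thesis"
    then have "x = 0\<^sub>v m" using assms(1) by (intro eq_vecI) auto
    then show False using assms(2) by simp
  qed
  then show thesis using that by blast
qed

text \<open>An enumeration-free description of the adjacency spectrum.\<close>

lemma spectrum_adjacency_matrix_iff:
  assumes d: "distinct vs" and s: "set vs = pverts G"
  shows "k \<in> spectrum (adjacency_matrix vs G) \<longleftrightarrow>
    (\<exists>x. (\<exists>v \<in> pverts G. x v \<noteq> 0) \<and>
      (\<forall>v \<in> pverts G. (\<Sum>w \<in> pverts G. if (v, w) \<in> parcs G then x w else 0) = k * x v))"
    (is "?L \<longleftrightarrow> ?R")
proof -
  let ?n = "length vs" and ?A = "adjacency_matrix vs G"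
  have bij: "bij_betw (\<lambda>i. vs ! i) {..<?n} (pverts G)"
    using bij_betw_nth[OF d] s by simp
  have inV: "vs ! i \<in> pverts G" if "i < ?n" for i
    using nth_mem[OF that] unfolding s .
  have nthV: thesis if "v \<in> pverts G" "\<And>i. i < ?n \<Longrightarrow> v = vs ! i \<Longrightarrow> thesis" for v thesis
    using that unfolding s[symmetric] by (metis in_set_conv_nth)
  have mv: "(?A *\<^sub>v x) $ i = (\<Sum>w \<in> pverts G. if (vs ! i, w) \<in> parcs G then y w else 0)"
    if i: "i < ?n" and x: "x \<in> carrier_vec ?n" and xy: "\<And>j. j < ?n \<Longrightarrow> x $ j = y (vs ! j)" for x y i
  proof -
    have "(?A *\<^sub>v x) $ i = (\<Sum>j \<in> {..<?n}. if (vs ! i, vs ! j) \<in> parcs G then y (vs ! j) else 0)"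
      using i x xy
      by (auto simp: adjacency_matrix_def scalar_prod_def atLeast0LessThan intro!: sum.cong)
    also have "\<dots> = (\<Sum>w \<in> pverts G. if (vs ! i, w) \<in> parcs G then y w else 0)"
      by (rule sum.reindex_bij_betw[OF bij])
    finally show ?thesis .
  qed
  have dim: "dim_row ?A = ?n" by (simp add: adjacency_matrix_def)
  have spec: "k \<in> spectrum ?A \<longleftrightarrow>
      (\<exists>x. x \<in> carrier_vec ?n \<and> x \<noteq> 0\<^sub>v ?n \<and> ?A *\<^sub>v x = k \<cdot>\<^sub>v x)"
    by (simp add: spectrum_def eigenvalue_def eigenvector_def dim)
  show ?thesis
  proof
    assume ?L
    then obtain x where x: "x \<in> carrier_vec ?n" "x \<noteq> 0\<^sub>v ?n" "?A *\<^sub>v x = k \<cdot>\<^sub>v x"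
      unfolding spec by blast
    define y where "y v = x $ (the_inv_into {..<?n} (\<lambda>i. vs ! i) v)" for v
    have xy: "x $ j = y (vs ! j)" if "j < ?n" for j
      using the_inv_into_f_f[OF bij_betw_imp_inj_on[OF bij], of j] that by (simp add: y_def)
    obtain i where i: "i < ?n" "x $ i \<noteq> 0" by (rule nonzero_vec_entry[OF x(1,2)])
    have "\<forall>v \<in> pverts G. (\<Sum>w \<in> pverts G. if (v, w) \<in> parcs G then y w else 0) = k * y v"
    proof
      fix v assume v: "v \<in> pverts G"
      obtain j where j: "j < ?n" "v = vs ! j" by (rule nthV[OF v])
      have "(?A *\<^sub>v x) $ j = k * y (vs ! j)"
        unfolding x(3) xy[OF j(1), symmetric] using x(1) j(1) by simp
      then show "(\<Sum>w \<in> pverts G. if (v, w) \<in> parcs G then y w else 0) = k * y v"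
        unfolding j(2) using mv[OF j(1) x(1), where y = y] xy by simp
    qed
    moreover have "\<exists>v \<in> pverts G. y v \<noteq> 0"
      using i(2) unfolding xy[OF i(1)] by (rule bexI) (rule inV[OF i(1)])
    ultimately show ?R by blast
  next
    assume ?R
    then obtain y v where v: "v \<in> pverts G" "y v \<noteq> 0"
      and y: "\<And>v. v \<in> pverts G \<Longrightarrow>
        (\<Sum>w \<in> pverts G. if (v, w) \<in> parcs G then y w else 0) = k * y v" by blast
    define x where "x = vec ?n (\<lambda>i. y (vs ! i))"
    have x: "x \<in> carrier_vec ?n" and xy: "\<And>j. j < ?n \<Longrightarrow> x $ j = y (vs ! j)"
      by (auto simp: x_def)
    obtain i where i: "i < ?n" "v = vs ! i" by (rule nthV[OF v(1)])
    have "x \<noteq> 0\<^sub>v ?n"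
    proof
      assume "x = 0\<^sub>v ?n"
      then have "x $ i = 0" using i(1) by simp
      then show False using v(2) unfolding xy[OF i(1)] i(2) by simp
    qed
    moreover have "?A *\<^sub>v x = k \<cdot>\<^sub>v x"
    proof (rule eq_vecI)
      fix j assume "j < dim_vec (k \<cdot>\<^sub>v x)"
      then have j: "j < ?n" using x by simp
      have "(?A *\<^sub>v x) $ j = k * x $ j"
        using mv[OF j x, where y = y] xy y[OF inV[OF j]] j by simp
      then show "(?A *\<^sub>v x) $ j = (k \<cdot>\<^sub>v x) $ j" using j x by simp
    next
      show "dim_vec (?A *\<^sub>v x) = dim_vec (k \<cdot>\<^sub>v x)" using x dim by simp
    qed
    ultimately show ?L using x unfolding spec by blast
  qed
qed

lemma spectrum_adjacency_matrix_cong: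
  assumes "distinct vs" "set vs = pverts G" "distinct ws" "set ws = pverts G"
  shows "spectrum (adjacency_matrix vs G) = spectrum (adjacency_matrix ws G)"
  using spectrum_adjacency_matrix_iff[OF assms(1,2)] spectrum_adjacency_matrix_iff[OF assms(3,4)]
  by blast

lemma finite_spectrum_adjacency_matrix: "finite (spectrum (adjacency_matrix vs G))"
  by (rule card_finite_spectrum(1)[of _ "length vs"]) (simp add: adjacency_matrix_def)

text \<open>The real spectrum is nonempty, so the maximum defining the spectral radius is attained.\<close>

lemma spectrum_adjacency_matrix_nonempty:
  assumes G: "pair_graph G" and ne: "pverts G \<noteq> {}" and d: "distinct vs" and s: "set vs = pverts G"
  shows "spectrum (adjacency_matrix vs G) \<noteq> {}"
proof -
  interpret pair_graph G by fact
  let ?n = "length vs" and ?V = "pverts G"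
  define C :: "complex mat" where "C = map_mat of_real (adjacency_matrix vs G)"
  define a :: "nat \<Rightarrow> nat \<Rightarrow> real" where
    "a i j = (if (vs ! i, vs ! j) \<in> parcs G then 1 else 0)" for i j
  have sym_a: "a i j = a j i" for i j
    using pair_sym_arcs by (auto simp: a_def symmetric_def dest: symD)
  have C: "C \<in> carrier_mat ?n ?n" by (simp add: C_def adjacency_matrix_def)
  have n: "?n > 0" using ne s by (cases vs) auto
  obtain k where "k \<in> spectrum C" using spectrum_non_empty[OF C n] by blast
  then obtain z where z: "z \<in> carrier_vec ?n" "z \<noteq> 0\<^sub>v ?n" "C *\<^sub>v z = k \<cdot>\<^sub>v z"
    using C by (auto simp: spectrum_def eigenvalue_def eigenvector_def)
  have eq: "(\<Sum>j<?n. of_real (a i j) * z $ j) = k * z $ i" if "i < ?n" for i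
  proof -
    have "(C *\<^sub>v z) $ i = (\<Sum>j<?n. of_real (a i j) * z $ j)"
      using that z(1)
      by (auto simp: C_def adjacency_matrix_def scalar_prod_def a_def atLeast0LessThan intro!: sum.cong)
    then show ?thesis using z that by simp
  qed
  define N where "N = (\<Sum>i<?n. cmod (z $ i) ^ 2)"
  define Q where "Q = (\<Sum>i<?n. \<Sum>j<?n. cnj (z $ i) * of_real (a i j) * z $ j)"
  have Q: "Q = k * of_real N"
  proof -
    have "Q = (\<Sum>i<?n. cnj (z $ i) * (\<Sum>j<?n. of_real (a i j) * z $ j))"
      by (simp add: Q_def sum_distrib_left mult.assoc)
    also have "\<dots> = (\<Sum>i<?n. k * of_real (cmod (z $ i) ^ 2))"
    proof (intro sum.cong refl)
      fix i assume "i \<in> {..<?n}"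
      then have "cnj (z $ i) * (\<Sum>j<?n. of_real (a i j) * z $ j) = k * (z $ i * cnj (z $ i))"
        using eq[of i] by simp
      then show "cnj (z $ i) * (\<Sum>j<?n. of_real (a i j) * z $ j) = k * of_real (cmod (z $ i) ^ 2)"
        by (simp only: complex_norm_square)
    qed
    finally show ?thesis by (simp add: N_def sum_distrib_left)
  qed
  have "cnj Q = (\<Sum>i<?n. \<Sum>j<?n. cnj (z $ j) * of_real (a j i) * z $ i)"
    by (simp add: Q_def mult_ac sym_a)
  also have "\<dots> = Q" unfolding Q_def by (rule sum.swap)
  finally have cQ: "cnj Q = Q" .
  obtain i where i: "i < ?n" "z $ i \<noteq> 0" by (rule nonzero_vec_entry[OF z(1,2)])
  then have "N > 0" unfolding N_def by (intro sum_pos2[of _ i]) auto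
  with Q cQ have k: "k = of_real (Re k)" by (simp add: complex_eq_iff)
  define r where "r = Re k"
  have kr: "k = of_real r" using k by (simp add: r_def)
  obtain f :: "complex \<Rightarrow> real" where f: "f = Re \<or> f = Im" "f (z $ i) \<noteq> 0"
    using i(2) by (metis complex_eq_iff zero_complex.sel)
  define x where "x = vec ?n (\<lambda>j. f (z $ j))"
  have eqr: "(\<Sum>j<?n. a l j * f (z $ j)) = r * f (z $ l)" if "l < ?n" for l
  proof -
    have "f (\<Sum>j<?n. of_real (a l j) * z $ j) = f (of_real r * z $ l)"
      using eq[OF that] kr by simp
    with f(1) show ?thesis by auto
  qed
  have "adjacency_matrix vs G *\<^sub>v x = r \<cdot>\<^sub>v x"
  proof (rule eq_vecI)
    fix l assume "l < dim_vec (r \<cdot>\<^sub>v x)"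
    then have l: "l < ?n" by (simp add: x_def)
    have "(adjacency_matrix vs G *\<^sub>v x) $ l = (\<Sum>j<?n. a l j * f (z $ j))"
      using l by (auto simp: x_def adjacency_matrix_def scalar_prod_def a_def atLeast0LessThan
          intro!: sum.cong)
    then show "(adjacency_matrix vs G *\<^sub>v x) $ l = (r \<cdot>\<^sub>v x) $ l"
      using eqr[OF l] l by (simp add: x_def)
  qed (simp add: x_def adjacency_matrix_def)
  moreover have "x \<noteq> 0\<^sub>v ?n"
  proof
    assume "x = 0\<^sub>v ?n"
    then have "x $ i = 0" using i by simp
    then show False using f i by (simp add: x_def)
  qed
  moreover have "x \<in> carrier_vec ?n" "dim_row (adjacency_matrix vs G) = ?n"
    by (simp_all add: x_def adjacency_matrix_def)
  ultimately have "eigenvector (adjacency_matrix vs G) x r"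
    by (simp add: eigenvector_def)
  then have "r \<in> spectrum (adjacency_matrix vs G)"
    by (auto simp: spectrum_def eigenvalue_def)
  then show ?thesis by blast
qed

end

theory Submission
  imports Defs
begin

text \<open>
  If \<open>G\<close> is not 1-excludable, some edge \<open>e\<close> lies in every perfect matching, so \<open>H = G - e\<close> has
  none. Write \<open>m(v)\<close> for the number of non-neighbours of \<open>v\<close>. In an edge-maximal supergraph of
  \<open>H\<close> without a perfect matching, non-adjacent \<open>u, v\<close> satisfy \<open>m(u) + m(v) \<ge> n\<close> (an Ore-type
  condition that replaces Tutte's theorem). On the other hand \<open>\<rho>(G) > n - 3\<close> together with
  \<open>\<rho> (\<rho> - 1) \<le> 2 |E(G)| - 2 n + 2\<close> leaves at most \<open>2 n - 5\<close> edges missing from \<open>H\<close>. Counting missing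
  edges at a non-adjacent pair with minimal \<open>m(u) + m(v)\<close> then forces
  \<open>G = K\<^sub>1 \<or> (K\<^sub>2 \<union> K\<^sub>n\<^sub>-\<^sub>3)\<close>, or \<open>n \<le> 10\<close> and \<open>G \<subseteq> K\<^sub>s \<or> (K\<^sub>2 \<union> s K\<^sub>1)\<close> with \<open>s = n/2 - 1\<close>.
  Positive weights constant on the three parts of such a join compare its spectral radius with that of
  the extremal graph.
\<close>

section \<open>Dense graphs without a perfect matching\<close>

text \<open>Perfect matchings are encoded as involutions, so that exchanging matching edges is a
  function update; irreflexivity of \<open>E\<close> excludes fixed points.\<close>

definition involutive_matching :: "'a set \<Rightarrow> 'a rel \<Rightarrow> ('a \<Rightarrow> 'a) \<Rightarrow> bool" where
  "involutive_matching V E f \<longleftrightarrow> (\<forall>v\<in>V. f v \<in> V \<and> f (f v) = v \<and> (v, f v) \<in> E)"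

definition simple_arcs :: "'a set \<Rightarrow> 'a rel \<Rightarrow> bool" where
  "simple_arcs V E \<longleftrightarrow> E \<subseteq> V \<times> V \<and> sym E \<and> irrefl E"

definition missing :: "'a set \<Rightarrow> 'a rel \<Rightarrow> 'a \<Rightarrow> 'a set" where
  "missing V E v = {w \<in> V. w \<noteq> v \<and> (v, w) \<notin> E}"

lemma missing_sym:
  assumes "simple_arcs V E" "v \<in> V"
  shows "w \<in> missing V E v \<Longrightarrow> v \<in> missing V E w"
  using assms by (auto simp: missing_def simple_arcs_def dest: symD)

lemma finite_missing: "finite V \<Longrightarrow> finite (missing V E v)"
  by (simp add: missing_def)

lemma card_neighbours_missing:
  assumes "finite V" "simple_arcs V E" "v \<in> V"
  shows "card {w. (v, w) \<in> E} + card (missing V E v) + 1 = card V"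
proof -
  have V: "insert v ({w. (v, w) \<in> E} \<union> missing V E v) = V"
    using assms by (auto simp: missing_def simple_arcs_def)
  then have fin: "finite ({w. (v, w) \<in> E} \<union> missing V E v)"
    using assms(1) by (metis finite_insert)
  have "v \<notin> {w. (v, w) \<in> E} \<union> missing V E v"
    using assms by (auto simp: missing_def simple_arcs_def irrefl_def)
  then have "card V = Suc (card ({w. (v, w) \<in> E} \<union> missing V E v))"
    using card_insert_disjoint[OF fin, of v] V by metis
  also have "card ({w. (v, w) \<in> E} \<union> missing V E v) = card {w. (v, w) \<in> E} + card (missing V E v)"
    using fin by (intro card_Un_disjoint) (auto simp: missing_def)
  finally show ?thesis by simp
qed

text \<open>If \<open>w\<close> is a neighbour of \<open>u\<close> and \<open>f w\<close> one of \<open>v\<close>, then replacing the pairs \<open>u v\<close> and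
  \<open>w (f w)\<close> by \<open>u w\<close> and \<open>v (f w)\<close> gives a matching that avoids \<open>u v\<close>.\<close>

lemma card_le_missing_of_added_edge:
  assumes fin: "finite V" and E: "simple_arcs V E"
    and none: "\<nexists>g. involutive_matching V E g"
    and u: "u \<in> V" and v: "v \<in> missing V E u"
    and f: "involutive_matching V (insert (u, v) (insert (v, u) E)) f"
  shows "card V \<le> card (missing V E u) + card (missing V E v)"
proof -
  have fV: "f w \<in> V" and ff: "f (f w) = w"
    and fE: "(w, f w) \<in> insert (u, v) (insert (v, u) E)" if "w \<in> V" for w
    using f that unfolding involutive_matching_def by auto
  have vV: "v \<in> V" "v \<noteq> u" "(u, v) \<notin> E" "(v, u) \<notin> E"
    using v E by (auto simp: missing_def simple_arcs_def dest: symD)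
  have fu: "f u = v"
  proof (rule ccontr)
    assume "f u \<noteq> v"
    then have "involutive_matching V E f"
      using fV ff fE u vV unfolding involutive_matching_def by (metis insert_iff prod.inject)
    then show False using none by blast
  qed
  then have fv: "f v = u" using ff[OF u] by simp
  \<comment> \<open>As \<open>f\<close> is injective, this gives deg(u) \<le> m(v) - 1, while deg(u)
    = n - 1 - m(u).\<close>
  have "f ` {w. (u, w) \<in> E} \<subseteq> missing V E v - {u}"
  proof (rule image_subsetI)
    fix w assume "w \<in> {w. (u, w) \<in> E}"
    then have uw: "(u, w) \<in> E" "(w, u) \<in> E" and w: "w \<in> V"
      using E by (auto simp: simple_arcs_def dest: symD)
    have wne: "w \<noteq> u" "w \<noteq> v"
      using uw vV E by (auto simp: simple_arcs_def irrefl_def)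
    then have fwne: "f w \<noteq> u" "f w \<noteq> v" "f w \<noteq> w"
      using ff[OF w] fu fv fE[OF w] E by (auto simp: simple_arcs_def irrefl_def)
    have "(v, f w) \<notin> E"
    proof
      assume vw: "(v, f w) \<in> E"
      then have wv: "(f w, v) \<in> E" using E by (auto simp: simple_arcs_def dest: symD)
      define g where "g = f(u := w, w := u, v := f w, f w := v)"
      have g: "g u = w" "g w = u" "g v = f w" "g (f w) = v"
        using wne fwne vV by (simp_all add: g_def)
      have g': "g x = f x" if "x \<notin> {u, v, w, f w}" for x
        using that by (simp add: g_def)
      have "involutive_matching V E g"
        unfolding involutive_matching_def
      proof (intro ballI)
        fix x assume x: "x \<in> V"
        show "g x \<in> V \<and> g (g x) = x \<and> (x, g x) \<in> E"
        proof (cases "x \<in> {u, v, w, f w}")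
          case True
          then show ?thesis using g uw vw wv u vV(1) w fV[OF w] by auto
        next
          case False
          then have "f x \<notin> {u, v, w, f w}"
            using ff[OF x] ff[OF w] fu fv by auto
          then show ?thesis using False fV[OF x] ff[OF x] fE[OF x] g' by auto
        qed
      qed
      then show False using none by blast
    qed
    then show "f w \<in> missing V E v - {u}"
      using fV[OF w] fwne by (auto simp: missing_def)
  qed
  moreover have "inj_on f {w. (u, w) \<in> E}"
    using E ff by (intro inj_onI) (metis SigmaD2 mem_Collect_eq simple_arcs_def subsetD)
  ultimately have "card {w. (u, w) \<in> E} \<le> card (missing V E v - {u})"
    using finite_missing[OF fin] by (metis card_image card_mono finite_Diff)
  moreover have "u \<in> missing V E v" by (rule missing_sym[OF E u v])
  then have "card (missing V E v - {u}) < card (missing V E v)"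
    by (rule card_Diff1_less[OF finite_missing[OF fin]])
  ultimately show ?thesis using card_neighbours_missing[OF fin E u] by linarith
qed

text \<open>Any edge added to a maximal unmatchable edge set creates a matching, so the exchange
  argument applies to each non-adjacent pair.\<close>

lemma maximal_unmatchable_supergraph:
  assumes fin: "finite V" and E: "simple_arcs V E"
    and none: "\<nexists>g. involutive_matching V E g"
  obtains F where "E \<subseteq> F" "simple_arcs V F" "\<nexists>g. involutive_matching V F g"
    "\<And>u v. u \<in> V \<Longrightarrow> v \<in> missing V F u \<Longrightarrow>
       card V \<le> card (missing V F u) + card (missing V F v)"
proof -
  define \<F> where "\<F> = {F. simple_arcs V F \<and> (\<nexists>g. involutive_matching V F g)}"
  have "\<F> \<subseteq> Pow (V \<times> V)" by (auto simp: \<F>_def simple_arcs_def)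
  then have fin\<F>: "finite \<F>" by (rule finite_subset) (simp add: fin)
  have "E \<in> \<F>" using E none by (simp add: \<F>_def)
  then obtain F where F: "F \<in> \<F>" "E \<subseteq> F" and max: "\<forall>F'\<in>\<F>. F \<subseteq> F' \<longrightarrow> F = F'"
    using finite_has_maximal2[OF fin\<F>, of E] by auto
  have F': "simple_arcs V F" "\<nexists>g. involutive_matching V F g"
    using F by (auto simp: \<F>_def)
  have "card V \<le> card (missing V F u) + card (missing V F v)"
    if u: "u \<in> V" and v: "v \<in> missing V F u" for u v
  proof -
    let ?F = "insert (u, v) (insert (v, u) F)"
    have "F \<noteq> ?F" using v by (auto simp: missing_def)
    then have "?F \<notin> \<F>" using max subset_insertI2[OF subset_insertI, of F] by metis
    moreover have "simple_arcs V ?F"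
      using F'(1) u v by (auto simp: simple_arcs_def missing_def irrefl_def sym_def)
    ultimately obtain f where "involutive_matching V ?F f" by (auto simp: \<F>_def)
    then show ?thesis by (rule card_le_missing_of_added_edge[OF fin F' u v])
  qed
  then show thesis using that F(2) F' by blast
qed

text \<open>A bijection between two halves of \<open>V\<close>, glued to its inverse, works. Hence
  an unmatchable graph of even order has a non-adjacent pair.\<close>

lemma complete_involutive_matching:
  assumes "finite V" "even (card V)"
  obtains f where "involutive_matching V {(v, w). v \<in> V \<and> w \<in> V \<and> v \<noteq> w} f"
proof -
  obtain k where k: "card V = k + k" using assms(2) by (metis evenE mult_2)
  then obtain X where X: "X \<subseteq> V" "card X = k" by (metis obtain_subset_with_card_n le_add1)
  have "card (V - X) = k"
    using X k assms(1) by (simp add: card_Diff_subset finite_subset)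
  then obtain h where h: "bij_betw h X (V - X)"
    using finite_same_card_bij[of X "V - X"] X assms(1) finite_subset[OF X(1)] by auto
  define f where "f v = (if v \<in> X then h v else the_inv_into X h v)" for v
  have inj: "inj_on h X" and img: "h ` X = V - X" using h by (auto simp: bij_betw_def)
  have "f v \<in> V \<and> f (f v) = v \<and> v \<noteq> f v" if v: "v \<in> V" for v
  proof (cases "v \<in> X")
    case True
    then have "h v \<in> V - X" using img by blast
    then show ?thesis using True inj by (auto simp: f_def the_inv_into_f_f)
  next
    case False
    then have vh: "v \<in> h ` X" using img v by blast
    then have "the_inv_into X h v \<in> X" using inj by (metis the_inv_into_into order_refl)
    then show ?thesis using False X(1) inj vh by (auto simp: f_def f_the_inv_into_f)
  qed
  then have "involutive_matching V {(v, w). v \<in> V \<and> w \<in> V \<and> v \<noteq> w} f"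
    unfolding involutive_matching_def by auto
  then show thesis by (rule that)
qed

section \<open>Counting missing edges\<close>

lemma missing_count_cases:
  fixes k s t :: nat
  assumes "k \<ge> 3" "s \<le> t" "2 * k \<le> s + t" "t \<le> 2 * k - 2"
    and le: "s * t + (t + 1 - s) * s \<le> 8 * k - 10"
  shows "s = 2 \<and> t = 2 * k - 2 \<or> s = k \<and> k \<le> 5"
proof -
  define S T K where "S = int s" and "T = int t" and "K = int k"
  have KST: "K \<ge> 3" "S \<le> T" "2 * K \<le> S + T" "T \<le> 2 * K - 2"
    using assms(1-4) by (auto simp: S_def T_def K_def)
  have "int (s * t + (t + 1 - s) * s) \<le> int (8 * k - 10)"
    using le by (simp only: of_nat_le_iff)
  moreover have "int (t + 1 - s) = T + 1 - S" "int (8 * k - 10) = 8 * K - 10"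
    using assms(1,2) by (auto simp: S_def T_def K_def)
  ultimately have bound: "S * (2 * T + 1 - S) \<le> 8 * K - 10"
    by (simp only: of_nat_add of_nat_mult S_def[symmetric] T_def[symmetric]) (simp add: algebra_simps)
  have S2: "S \<ge> 2" using KST by linarith
  \<comment> \<open>For K < S \<le> T the bound becomes S^2 - 7 S + 18 \<le> 0, whose discriminant
    is negative.\<close>
  have "S \<le> K"
  proof (rule ccontr)
    assume "\<not> S \<le> K"
    then have "S * (S + 1) \<le> 8 * S - 18"
      using bound mult_left_mono[of "S + 1" "2 * T + 1 - S" S] KST S2 by linarith
    moreover have "(2 * S - 7) * (2 * S - 7) \<ge> 0" by simp
    ultimately show False by (simp add: algebra_simps)
  qed
  show ?thesis
  proof (cases "S = 2")
    case True
    then show ?thesis using KST by (auto simp: S_def T_def K_def)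
  next
    case False
    then have S3: "S \<ge> 3" using S2 by linarith
    \<comment> \<open>Inserting T \<ge> 2 K - S makes the difference of both sides factor through S
      - 2; for S \<ge> 3 the other factor forces K = S \<le> 5.\<close>
    have "S * (4 * K + 1 - 3 * S) \<le> 8 * K - 10"
      using bound mult_left_mono[of "4 * K + 1 - 3 * S" "2 * T + 1 - S" S] KST S2 by linarith
    then have "(S - 2) * (S - 5 + 4 * (K - S)) \<le> 0" by (simp add: algebra_simps)
    then have "S - 5 + 4 * (K - S) \<le> 0" using S3 by (simp add: mult_le_0_iff)
    then have "K = S \<and> K \<le> 5" using S3 \<open>S \<le> K\<close> by presburger
    then show ?thesis by (auto simp: S_def K_def)
  qed
qed

text \<open>At a non-adjacent pair with least m(u) + m(v), every vertex missing from
  \<open>u\<close> or \<open>v\<close> has large m itself, which leaves two ways to respect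
  \<open>total\<close>: two leaves \<open>a\<close>, \<open>b\<close> at a common neighbour
  \<open>c\<close> of an otherwise complete graph, or an independent set on more than half of the
  vertices.\<close>

lemma dense_unmatchable_cases:
  assumes fin: "finite V" and card: "card V = 2 * k" and k: "k \<ge> 3"
    and E: "simple_arcs V E" and none: "\<nexists>g. involutive_matching V E g"
    and deg: "\<forall>v\<in>V. card (missing V E v) \<le> 2 * k - 2"
    and total: "(\<Sum>v\<in>V. card (missing V E v)) \<le> 8 * k - 10"
  obtains
    (pendants) a b c where "a \<in> V" "b \<in> V" "c \<in> V" "a \<noteq> b" "a \<noteq> c" "b \<noteq> c"
      "E = {(v, w). v \<in> V \<and> w \<in> V \<and> v \<noteq> w \<and> (v = c \<or> w = c \<or> {v, w} \<inter> {a, b} = {})}"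
  | (independent) W where "k \<le> 5" "W \<subseteq> V" "card W = k + 1" "E \<inter> W \<times> W = {}"
proof -
  obtain F where EF: "E \<subseteq> F" and F: "simple_arcs V F" and noneF: "\<nexists>g. involutive_matching V F g"
    and ore: "\<And>u v. u \<in> V \<Longrightarrow> v \<in> missing V F u \<Longrightarrow>
       2 * k \<le> card (missing V F u) + card (missing V F v)"
    using maximal_unmatchable_supergraph[OF fin E none] unfolding card by metis
  define m where "m v = card (missing V F v)" for v
  have mE: "m v \<le> card (missing V E v)" for v
    unfolding m_def using EF by (intro card_mono finite_missing fin) (auto simp: missing_def)
  have m: "m v \<le> 2 * k - 2" if "v \<in> V" for v using bspec[OF deg that] mE[of v] by linarith
  have totalF: "sum m V \<le> 8 * k - 10"
    using sum_mono[of V m, OF mE] total by linarith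
  have sub: "sum m X \<le> 8 * k - 10" if "X \<subseteq> V" for X
    using sum_mono2[OF fin that, of m] totalF by simp
  have sumge: "c * card X \<le> sum m X" if "\<And>x. x \<in> X \<Longrightarrow> c \<le> m x" for c X
    using sum_bounded_below[of X c m] that by (simp add: mult.commute)
  have finm: "finite (missing V F v)" for v by (rule finite_missing[OF fin])
  have finX: "finite X" if "X \<subseteq> V" for X using fin that by (rule rev_finite_subset)
  have "\<exists>u\<in>V. \<exists>v. v \<in> missing V F u"
  proof (rule ccontr)
    assume "\<not> ?thesis"
    then have *: "{(v, w). v \<in> V \<and> w \<in> V \<and> v \<noteq> w} \<subseteq> F" by (auto simp: missing_def)
    obtain f where "involutive_matching V {(v, w). v \<in> V \<and> w \<in> V \<and> v \<noteq> w} f"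
      using complete_involutive_matching[OF fin] card by auto
    then have "involutive_matching V F f" using * unfolding involutive_matching_def by blast
    then show False using noneF by blast
  qed
  then obtain p0 where p0: "fst p0 \<in> V \<and> snd p0 \<in> missing V F (fst p0)" by force
  obtain p where p: "fst p \<in> V \<and> snd p \<in> missing V F (fst p)"
    and pmin: "\<And>q. fst q \<in> V \<and> snd q \<in> missing V F (fst q) \<Longrightarrow>
        m (fst p) + m (snd p) \<le> m (fst q) + m (snd q)"
    using ex_has_least_nat[of "\<lambda>p. fst p \<in> V \<and> snd p \<in> missing V F (fst p)" p0
        "\<lambda>p. m (fst p) + m (snd p)"] p0 by metis
  have "\<exists>u v. u \<in> V \<and> v \<in> V \<and> v \<in> missing V F u \<and> m v \<le> m u \<and>
      (\<forall>x\<in>V. \<forall>y \<in> missing V F x. m u + m v \<le> m x + m y)"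
  proof (cases "m (snd p) \<le> m (fst p)")
    case True
    then show ?thesis using p pmin
      by (intro exI[of _ "fst p"] exI[of _ "snd p"]) (auto simp: missing_def)
  next
    case False
    moreover have "snd p \<in> V" using p by (simp add: missing_def)
    moreover have "fst p \<in> missing V F (snd p)" using missing_sym[OF F] p by blast
    ultimately show ?thesis using p pmin
      by (intro exI[of _ "snd p"] exI[of _ "fst p"]) (auto simp: add.commute)
  qed
  then obtain u v where u: "u \<in> V" and v: "v \<in> V" and uv: "v \<in> missing V F u"
    and vu: "m v \<le> m u"
    and least: "\<And>x y. x \<in> V \<Longrightarrow> y \<in> missing V F x \<Longrightarrow> m u + m v \<le> m x + m y" by blast
  \<comment> \<open>Minimality gives m \<ge> m(u) on \<open>X\<close> and m \<ge> m(v) on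
    \<open>Y\<close>. Summing m over \<open>X\<close> and \<open>Y - X\<close> yields the quadratic
    bound.\<close>
  define X Y where "X = missing V F v" and "Y = insert u (missing V F u)"
  have XV: "X \<subseteq> V" and YV: "Y \<subseteq> V" using u by (auto simp: X_def Y_def missing_def)
  have mX: "m u \<le> m x" if "x \<in> X" for x
    using least[OF v, of x] that by (simp add: X_def)
  have mY: "m v \<le> m y" if "y \<in> Y" for y
    using least[OF u, of y] that vu by (auto simp: Y_def)
  have cX: "card X = m v" and cY: "card Y = m u + 1"
    by (auto simp: X_def Y_def m_def finm missing_def fin)
  have cYX: "m u + 1 - m v \<le> card (Y - X)"
    using diff_card_le_card_Diff[OF finX[OF XV], of Y] cX cY by simp
  have "sum m X + sum m (Y - X) = sum m (X \<union> Y)"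
    using sum.union_disjoint[of X "Y - X" m] finX XV YV by (metis Diff_disjoint Un_Diff_cancel finite_Diff)
  moreover have "m v * m u \<le> sum m X" using sumge[of X "m u"] mX cX by (simp add: mult.commute)
  moreover have "(m u + 1 - m v) * m v \<le> sum m (Y - X)"
  proof -
    have "(m u + 1 - m v) * m v \<le> card (Y - X) * m v" using cYX by (rule mult_right_mono) simp
    also have "\<dots> \<le> sum m (Y - X)"
      using sumge[of "Y - X" "m v"] mY by (simp add: mult.commute)
    finally show ?thesis .
  qed
  ultimately have "m v * m u + (m u + 1 - m v) * m v \<le> 8 * k - 10"
    using sub[OF Un_least[OF XV YV]] by linarith
  moreover have "2 * k \<le> m v + m u" using ore[OF u uv] by (simp add: m_def)
  ultimately consider "m v = 2" "m u = 2 * k - 2" | "m v = k" "k \<le> 5"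
    using missing_count_cases[OF k vu _ m[OF u]] by blast
  then show thesis
  proof cases
    case 1
    \<comment> \<open>Here \<open>v\<close> misses exactly two vertices, \<open>a\<close> and
      \<open>b\<close>; both have m = 2 k - 2, hence degree one in \<open>F\<close>.\<close>
    define a where "a = u"
    have aX: "a \<in> X" using missing_sym[OF F u uv] by (simp add: X_def a_def)
    have "card X = 2" using cX 1 by simp
    then obtain b where b: "X = {a, b}" "a \<noteq> b"
      using aX by (metis card_2_iff doubleton_eq_iff insertE singletonD)
    have abV: "a \<in> V" "b \<in> V" using b XV by auto
    have mab: "m a = 2 * k - 2" "m b = 2 * k - 2"
      using 1 b mX[of b] m[OF abV(2)] by (auto simp: a_def)
    have nbr: "\<exists>c. {w. (x, w) \<in> F} = {c}" if "x \<in> V" "m x = 2 * k - 2" for x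
    proof -
      have "card {w. (x, w) \<in> F} = 1"
        using card_neighbours_missing[OF fin F that(1)] that(2) card k by (simp add: m_def)
      then show ?thesis by (rule card_1_singletonE) blast
    qed
    obtain c where c: "{w. (a, w) \<in> F} = {c}" using nbr abV mab by blast
    obtain c' where c': "{w. (b, w) \<in> F} = {c'}" using nbr abV mab by blast
    have cF: "(a, c) \<in> F" using c by blast
    then have cV: "c \<in> V" and ca: "c \<noteq> a"
      using F by (auto simp: simple_arcs_def irrefl_def)
    define R where "R = V - {a, b, c}"
    have RV: "R \<subseteq> V" by (auto simp: R_def)
    have mR: "2 \<le> m w" if "w \<in> R" for w
    proof -
      have "w \<in> Y" using that c by (auto simp: R_def Y_def a_def missing_def)
      then show ?thesis using mY 1 by auto
    qed
    have cR: "2 * k \<le> card R + card {a, b, c}"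
      using diff_card_le_card_Diff[of "{a, b, c}" V] card by (simp add: R_def)
    have tot: "sum m R + sum m {a, b, c} = sum m V"
      using sum.subset_diff[of "{a, b, c}" V m] fin abV cV by (simp add: R_def)
    have sumR: "2 * card R \<le> sum m R" using sumge[of R 2] mR by simp
    \<comment> \<open>If \<open>a\<close> and \<open>b\<close> were adjacent, the 2 k - 2 other
      vertices with m \<ge> 2 would raise the sum to 8 k - 8.\<close>
    have cb: "c \<noteq> b"
    proof
      assume "c = b"
      then have "card {a, b, c} = 2" "sum m {a, b, c} = 4 * k - 4" using b mab k by auto
      then show False using tot totalF sumR cR k by linarith
    qed
    have c3: "card {a, b, c} = 3" "sum m {a, b, c} = 4 * k - 4 + m c" using b ca cb mab k by auto
    \<comment> \<open>The bounds 2 (2 k - 3) on \<open>R\<close> and 4 k - 4 on \<open>a\<close>,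
      \<open>b\<close> already exhaust 8 k - 10, so they are equalities and \<open>c\<close> misses
      nothing.\<close>
    then have mc: "m c = 0" and totR: "sum m R \<le> 2 * card R" and ge: "8 * k - 10 \<le> sum m V"
      using tot totalF sumR cR k by linarith+
    have cadj: "(c, w) \<in> F" "(w, c) \<in> F" if "w \<in> V" "w \<noteq> c" for w
    proof -
      have "missing V F c = {}" using mc finm by (simp add: m_def)
      then show "(c, w) \<in> F" using that by (auto simp: missing_def)
      then show "(w, c) \<in> F" using F by (auto simp: simple_arcs_def dest: symD)
    qed
    have "(b, c) \<in> F" using cadj(2) abV cb by blast
    then have nb: "(b, w) \<in> F \<longleftrightarrow> w = c" for w using c' by (simp add: set_eq_iff)
    have na: "(a, w) \<in> F \<longleftrightarrow> w = c" for w using c by (simp add: set_eq_iff)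
    have missR: "missing V F w = {a, b}" if w: "w \<in> R" for w
    proof -
      have "{a, b} \<subseteq> missing V F w"
        using w F abV na nb by (auto simp: R_def missing_def simple_arcs_def dest: symD)
      moreover have "m w = 2"
      proof (rule ccontr)
        assume "m w \<noteq> 2"
        then have "2 < m w" using mR[OF w] by linarith
        then have "(\<Sum>x\<in>R. 2) < sum m R"
          using mR w by (intro sum_strict_mono_ex1 finX RV) auto
        then show False using totR by simp
      qed
      ultimately show ?thesis using finm[of w] b(2) by (intro card_subset_eq[symmetric]) (auto simp: m_def)
    qed
    have Fin: "F = {(v, w). v \<in> V \<and> w \<in> V \<and> v \<noteq> w \<and> (v = c \<or> w = c \<or> {v, w} \<inter> {a, b} = {})}"
      (is "F = ?F")
    proof -
      have "(x, y) \<in> F \<longleftrightarrow> (x, y) \<in> ?F" if xy: "x \<in> V" "y \<in> V" "x \<noteq> y" for x y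
      proof -
        have symF: "(x, y) \<in> F \<longleftrightarrow> (y, x) \<in> F" using F by (auto simp: simple_arcs_def dest: symD)
        consider "x = c \<or> y = c" | "x \<noteq> c" "y \<noteq> c" "x \<in> {a, b} \<or> y \<in> {a, b}"
          | "x \<in> R" "y \<in> R" using xy by (auto simp: R_def)
        then show ?thesis
        proof cases
          case 1 then show ?thesis using cadj xy by auto
        next
          case 2 then show ?thesis using na nb symF by auto
        next
          case 3
          then have "y \<notin> missing V F x" using missR by (auto simp: R_def)
          then show ?thesis using 3 xy by (auto simp: missing_def R_def)
        qed
      qed
      moreover have "F \<subseteq> {(x, y). x \<in> V \<and> y \<in> V \<and> x \<noteq> y}"
        using F by (auto simp: simple_arcs_def irrefl_def)
      ultimately show ?thesis by auto
    qed
    \<comment> \<open>\<open>F\<close> attains the maximal total, so an arc of \<open>F\<close>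
      absent from \<open>E\<close> would push the total of \<open>E\<close> above it.\<close>
    have "F \<subseteq> E"
    proof (rule ccontr)
      assume "\<not> F \<subseteq> E"
      then obtain x y where xy: "(x, y) \<in> F" "(x, y) \<notin> E" by auto
      then have x: "x \<in> V" and y: "y \<in> V" "y \<noteq> x" using F by (auto simp: simple_arcs_def irrefl_def)
      have "missing V F x \<subset> missing V E x"
        using EF xy x y by (auto simp: missing_def)
      then have "m x < card (missing V E x)"
        unfolding m_def by (intro psubset_card_mono finite_missing fin)
      then have "sum m V < (\<Sum>v\<in>V. card (missing V E v))"
        using mE x by (intro sum_strict_mono_ex1 fin) auto
      then show False using ge total by linarith
    qed
    then have "E = F" using EF by blast
    then show thesis using pendants[of a b c] abV cV b(2) ca cb Fin by auto
  next
    case 2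
    \<comment> \<open>\<open>W\<close> contains \<open>Y\<close>, which has at least k + 1 elements.
      By (k - 3) (k - 4) \<ge> 0 the total is at most k^2 + k + 2, too little for k + 2 vertices
      with m \<ge> k.\<close>
    define W where "W = {w \<in> V. k \<le> m w}"
    have WV: "W \<subseteq> V" by (auto simp: W_def)
    have "(int k - 3) * (int k - 4) \<ge> 0" using k by (cases "k = 3") auto
    then have "int (8 * k) \<le> int (k * k + k + 12)" by (simp add: algebra_simps)
    then have small: "8 * k - 10 \<le> k * k + k + 2" by linarith
    have "Y \<subseteq> W" using YV mY 2 by (auto simp: W_def)
    then have "card Y \<le> card W" using finX[OF WV] by (rule card_mono[rotated])
    moreover have "card W \<le> k + 1"
    proof (rule ccontr)
      assume "\<not> card W \<le> k + 1"
      then have "k * (k + 2) \<le> k * card W" by (intro mult_left_mono) auto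
      also have "\<dots> \<le> sum m W" by (rule sumge) (simp add: W_def)
      also have "\<dots> \<le> k * k + k + 2" using sub[OF WV] small by linarith
      finally show False using k by (simp add: algebra_simps)
    qed
    ultimately have cW: "card W = k + 1" using cY vu 2 by linarith
    \<comment> \<open>If \<open>a\<close>, \<open>b\<close> in \<open>W\<close> were adjacent,
      \<open>W\<close> would offer only k - 1 of the at least k vertices missing from
      \<open>a\<close>. Some \<open>x\<close> outside \<open>W\<close> is then missing too, and
      \<open>a\<close>, \<open>x\<close> contribute 2 k on top of k^2 from the rest of
      \<open>W\<close>.\<close>
    have "F \<inter> W \<times> W = {}"
    proof (rule ccontr)
      assume "F \<inter> W \<times> W \<noteq> {}"
      then obtain a b where ab: "(a, b) \<in> F" "a \<in> W" "b \<in> W" by blast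
      then have "a \<noteq> b" using F by (auto simp: simple_arcs_def irrefl_def)
      have "\<not> missing V F a \<subseteq> W - {a, b}"
      proof
        assume "missing V F a \<subseteq> W - {a, b}"
        then have "m a \<le> card (W - {a, b})" unfolding m_def by (intro card_mono) (auto simp: finX WV)
        also have "\<dots> = k - 1" using ab \<open>a \<noteq> b\<close> cW finX[OF WV] by (simp add: card_Diff_subset)
        finally show False using ab(2) k by (auto simp: W_def)
      qed
      then obtain x where x: "x \<in> missing V F a" "x \<notin> W - {a, b}" by blast
      then have xW: "x \<notin> W" "x \<in> V" using ab by (auto simp: missing_def)
      have max: "2 * k \<le> m a + m x" using ore[of a x] x(1) ab WV by (auto simp: m_def)
      have "k * k = k * card (W - {a})" using ab cW finX[OF WV] by simp
      also have "\<dots> \<le> sum m (W - {a})" by (rule sumge) (simp add: W_def)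
      finally have "k * k + 2 * k \<le> sum m (W - {a}) + (m a + m x)" using max by linarith
      also have "\<dots> = sum m (insert x W)"
        using ab xW finX[OF WV] by (simp add: sum.remove[of W a])
      also have "\<dots> \<le> k * k + k + 2" using sub[of "insert x W"] WV xW small by auto
      finally show False using k by linarith
    qed
    then have "E \<inter> W \<times> W = {}" using EF by blast
    then show thesis using independent[of W] 2 WV cW by blast
  qed
qed

text \<open>Arcs pair up with their reverses. Parity later sharpens a strict lower bound on the
  number of arcs.\<close>

lemma even_card_symmetric:
  assumes "finite E" "sym E" "irrefl E"
  shows "even (card E)"
  using assms
proof (induction "card E" arbitrary: E rule: less_induct)
  case less
  show ?case
  proof (cases "E = {}")
    case False
    then obtain x y where xy: "(x, y) \<in> E" by auto
    then have yx: "(y, x) \<in> E" "x \<noteq> y" using less.prems by (auto simp: irrefl_def dest: symD)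
    let ?E = "E - {(x, y), (y, x)}"
    have "card {(x, y), (y, x)} = 2" using yx by simp
    then have c: "card E = card ?E + 2"
      using xy yx less.prems(1) card_Diff_subset[of "{(x, y), (y, x)}" E]
        card_mono[of E "{(x, y), (y, x)}"] by simp
    have "even (card ?E)"
      using c less.prems by (intro less.hyps) (auto simp: sym_def irrefl_def)
    then show ?thesis using c by simp
  qed simp
qed

section \<open>Bounds on the spectral radius\<close>

text \<open>The entry at \<open>v\<close> of the adjacency matrix applied to \<open>x\<close>, free
  of any vertex enumeration.\<close>

definition nbr_sum :: "'a pair_pre_digraph \<Rightarrow> ('a \<Rightarrow> real) \<Rightarrow> 'a \<Rightarrow> real" where
  "nbr_sum G x v = (\<Sum>w\<in>pverts G. if (v, w) \<in> parcs G then x w else 0)"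

lemma eigenvalue_le_spectral_radius:
  assumes G: "pair_graph G" and v: "v \<in> pverts G" "x v \<noteq> 0"
    and x: "\<And>v. v \<in> pverts G \<Longrightarrow> nbr_sum G x v = k * x v"
  shows "k \<le> \<rho> G"
proof -
  interpret pair_graph G by fact
  note enum = vertex_enum[OF pair_finite_verts]
  have "k \<in> spectrum (adjacency_matrix (vertex_enum G) G)"
    unfolding spectrum_adjacency_matrix_iff[OF enum] using v x by (auto simp: nbr_sum_def)
  then show ?thesis
    unfolding graph_spectral_radius_def by (rule Max_ge[OF finite_spectrum_adjacency_matrix])
qed

text \<open>The absolute value of an eigenvector serves in place of a Perron vector.\<close>

lemma spectral_radius_subharmonic:
  assumes G: "pair_graph G" and ne: "pverts G \<noteq> {}"
  obtains y u where "\<And>v. 0 \<le> y v" "u \<in> pverts G" "0 < y u"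
    "\<And>v. v \<in> pverts G \<Longrightarrow> \<rho> G * y v \<le> nbr_sum G y v"
proof -
  interpret pair_graph G by fact
  note enum = vertex_enum[OF pair_finite_verts]
  have "\<rho> G \<in> spectrum (adjacency_matrix (vertex_enum G) G)"
    unfolding graph_spectral_radius_def
    by (rule Max_in[OF finite_spectrum_adjacency_matrix
          spectrum_adjacency_matrix_nonempty[OF G ne enum]])
  then obtain x u where u: "u \<in> pverts G" "x u \<noteq> 0"
    and x: "\<And>v. v \<in> pverts G \<Longrightarrow> nbr_sum G x v = \<rho> G * x v"
    unfolding spectrum_adjacency_matrix_iff[OF enum] nbr_sum_def by blast
  have "\<rho> G * \<bar>x v\<bar> \<le> nbr_sum G (\<lambda>w. \<bar>x w\<bar>) v" if "v \<in> pverts G" for v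
  proof -
    have "\<rho> G * \<bar>x v\<bar> \<le> \<bar>\<rho> G * x v\<bar>" by (simp add: abs_mult mult_right_mono)
    also have "\<dots> = \<bar>nbr_sum G x v\<bar>" by (simp only: x[OF that])
    also have "\<dots> \<le> (\<Sum>w\<in>pverts G. \<bar>if (v, w) \<in> parcs G then x w else 0\<bar>)"
      unfolding nbr_sum_def by (rule sum_abs)
    also have "\<dots> = nbr_sum G (\<lambda>w. \<bar>x w\<bar>) v"
      unfolding nbr_sum_def by (intro sum.cong) auto
    finally show ?thesis .
  qed
  then show thesis using that[of "\<lambda>v. \<bar>x v\<bar>" u] u by simp
qed

lemma nbr_sum_adjoint:
  assumes "pair_graph G"
  shows "(\<Sum>v\<in>pverts G. x v * nbr_sum G y v) = (\<Sum>v\<in>pverts G. nbr_sum G x v * y v)"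
proof -
  interpret pair_graph G by fact
  have sym: "(v, w) \<in> parcs G \<longleftrightarrow> (w, v) \<in> parcs G" for v w
    using pair_sym_arcs by (auto simp: symmetric_def dest: symD)
  have "(\<Sum>v\<in>pverts G. x v * nbr_sum G y v) =
      (\<Sum>v\<in>pverts G. \<Sum>w\<in>pverts G. if (v, w) \<in> parcs G then x v * y w else 0)"
    by (simp add: nbr_sum_def sum_distrib_left if_distrib cong: if_cong)
  also have "\<dots> = (\<Sum>w\<in>pverts G. \<Sum>v\<in>pverts G. if (v, w) \<in> parcs G then x v * y w else 0)"
    by (rule sum.swap)
  also have "\<dots> = (\<Sum>w\<in>pverts G. nbr_sum G x w * y w)"
    unfolding nbr_sum_def sum_distrib_right by (intro sum.cong refl) (simp add: sym)
  finally show ?thesis .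
qed

text \<open>Pairing with a subharmonic \<open>y\<close> gives \<rho> (z, y) \<le> (z, A y) = (A z,
  y) \<le> c (z, y), where the inner product (z, y) is positive.\<close>

lemma spectral_radius_le_of_superharmonic:
  assumes G: "pair_graph G" and ne: "pverts G \<noteq> {}"
    and pos: "\<And>v. v \<in> pverts G \<Longrightarrow> 0 < z v"
    and z: "\<And>v. v \<in> pverts G \<Longrightarrow> nbr_sum G z v \<le> c * z v"
  shows "\<rho> G \<le> c"
proof -
  interpret pair_graph G by fact
  obtain y u where y: "\<And>v. 0 \<le> y v" and u: "u \<in> pverts G" "0 < y u"
    and sub: "\<And>v. v \<in> pverts G \<Longrightarrow> \<rho> G * y v \<le> nbr_sum G y v"
    using spectral_radius_subharmonic[OF G ne] by blast
  have P: "0 < (\<Sum>v\<in>pverts G. z v * y v)"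
    using u pos y by (intro sum_pos2[OF pair_finite_verts u(1)]) (simp_all add: less_imp_le)
  have "\<rho> G * (\<Sum>v\<in>pverts G. z v * y v) = (\<Sum>v\<in>pverts G. z v * (\<rho> G * y v))"
    by (simp add: sum_distrib_left mult_ac)
  also have "\<dots> \<le> (\<Sum>v\<in>pverts G. z v * nbr_sum G y v)"
    using pos sub by (intro sum_mono mult_left_mono) (auto intro: less_imp_le)
  also have "\<dots> = (\<Sum>v\<in>pverts G. nbr_sum G z v * y v)" by (rule nbr_sum_adjoint[OF G])
  also have "\<dots> \<le> (\<Sum>v\<in>pverts G. c * z v * y v)"
    using y z by (intro sum_mono mult_right_mono) auto
  also have "\<dots> = c * (\<Sum>v\<in>pverts G. z v * y v)" by (simp add: sum_distrib_left mult_ac)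
  finally show ?thesis using P by simp
qed

lemma connected_closed_set:
  assumes G: "pair_graph G" and conn: "Digraph_Component.connected (with_proj G)"
    and u: "u \<in> pverts G" "u \<in> Z" and v: "v \<in> pverts G"
    and closed: "\<And>x y. (x, y) \<in> parcs G \<Longrightarrow> x \<in> Z \<Longrightarrow> y \<in> Z"
  shows "v \<in> Z"
proof -
  interpret pair_graph G by fact
  have "strongly_connected (with_proj G)"
    by (rule symmetric_connected_imp_strongly_connected[OF pair_sym_arcs conn])
  then have "u \<rightarrow>\<^sup>*\<^bsub>with_proj G\<^esub> v" using u v by (auto simp: strongly_connected_def)
  then have "(u, v) \<in> rtrancl_on (pverts G) (parcs G)" by (simp add: reachable_def)
  then show ?thesis by (induct rule: rtrancl_on_induct) (use u closed in auto)
qed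

text \<open>Equality would make the pairing argument tight at every vertex: \<open>y\<close>
  vanishes at \<open>a\<close>, and each zero of \<open>y\<close> spreads to its neighbours, hence
  by connectivity to all of \<open>G\<close>.\<close>

lemma spectral_radius_less_of_superharmonic:
  assumes G: "pair_graph G" and conn: "Digraph_Component.connected (with_proj G)"
    and pos: "\<And>v. v \<in> pverts G \<Longrightarrow> 0 < z v"
    and z: "\<And>v. v \<in> pverts G \<Longrightarrow> nbr_sum G z v \<le> c * z v"
    and strict: "a \<in> pverts G" "nbr_sum G z a < c * z a"
  shows "\<rho> G < c"
proof (rule ccontr)
  assume "\<not> \<rho> G < c"
  have ne: "pverts G \<noteq> {}" using strict by blast
  interpret pair_graph G by fact
  have \<rho>: "\<rho> G = c"
    using spectral_radius_le_of_superharmonic[OF G ne pos z] \<open>\<not> \<rho> G < c\<close> by linarith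
  obtain y u where y: "\<And>v. 0 \<le> y v" and u: "u \<in> pverts G" "0 < y u"
    and sub: "\<And>v. v \<in> pverts G \<Longrightarrow> c * y v \<le> nbr_sum G y v"
    using spectral_radius_subharmonic[OF G ne] \<rho> by metis
  \<comment> \<open>The nonnegative slacks of the two inequalities in the pairing; by adjointness
    they sum to zero.\<close>
  define s t where "s v = z v * (nbr_sum G y v - c * y v)"
    and "t v = (c * z v - nbr_sum G z v) * y v" for v
  have s0: "0 \<le> s v" and t0: "0 \<le> t v" if "v \<in> pverts G" for v
    using sub[OF that] z[OF that] y[of v] pos[OF that] by (simp_all add: s_def t_def)
  have "sum s (pverts G) + sum t (pverts G) = 0"
    using nbr_sum_adjoint[OF G, of z y]
    by (simp add: s_def t_def algebra_simps sum_subtractf)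
  then have "sum s (pverts G) = 0" "sum t (pverts G) = 0"
    using sum_nonneg[of "pverts G" s, OF s0] sum_nonneg[of "pverts G" t, OF t0] by linarith+
  then have st: "s v = 0" "t v = 0" if "v \<in> pverts G" for v
    using that s0 t0 by (simp_all add: sum_nonneg_eq_0_iff[OF pair_finite_verts])
  have "y a = 0" using st(2)[OF strict(1)] strict(2) by (simp add: t_def)
  have zero: "y w = 0" if vw: "(v, w) \<in> parcs G" and "y v = 0" for v w
  proof -
    have V: "v \<in> pverts G" "w \<in> pverts G" using vw by (auto dest: in_arcsD1 in_arcsD2)
    have "nbr_sum G y v = 0" using st(1)[OF V(1)] pos[OF V(1)] \<open>y v = 0\<close> by (simp add: s_def)
    then have "\<forall>w\<in>pverts G. (if (v, w) \<in> parcs G then y w else 0) = 0"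
      unfolding nbr_sum_def using y by (subst (asm) sum_nonneg_eq_0_iff[OF pair_finite_verts]) auto
    then show ?thesis using V vw by auto
  qed
  have "u \<in> {v. y v = 0}"
    by (rule connected_closed_set[OF G conn strict(1) _ u(1)]) (use zero \<open>y a = 0\<close> in simp_all)
  then show False using u by simp
qed

section \<open>Degree sums and the edge bound\<close>

lemma nbr_sum_one:
  assumes "pair_graph G"
  shows "nbr_sum G (\<lambda>_. 1) v = card {w. (v, w) \<in> parcs G}"
proof -
  interpret pair_graph G by fact
  have "{w \<in> pverts G. (v, w) \<in> parcs G} = {w. (v, w) \<in> parcs G}" by (auto dest: in_arcsD2)
  then show ?thesis
    by (simp add: nbr_sum_def sum.If_cases pair_finite_verts Int_def)
qed

lemma sum_out_neighbours:
  assumes "finite V" "E \<subseteq> V \<times> V"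
  shows "(\<Sum>v\<in>V. card {w. (v, w) \<in> E}) = card E"
proof -
  have "Sigma V (\<lambda>v. {w. (v, w) \<in> E}) = E" using assms(2) by auto
  moreover have "finite {w. (v, w) \<in> E}" for v
    using assms by (auto intro: rev_finite_subset)
  ultimately show ?thesis using assms(1) card_SigmaI[of V "\<lambda>v. {w. (v, w) \<in> E}"] by metis
qed

text \<open>With \<open>A\<close> the adjacency matrix, every column of \<open>A\<^sup>2 - A\<close> sums to at most
  \<open>2 m - 2 n + 2\<close>: the neighbours of a vertex carry all degrees except that of the vertex itself
  and those, at least two, of its non-neighbours.\<close>

lemma spectral_radius_edge_bound:
  assumes G: "pair_graph G" and ne: "pverts G \<noteq> {}"
    and deg: "\<And>v. v \<in> pverts G \<Longrightarrow> 2 \<le> card {w. (v, w) \<in> parcs G}"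
    and \<rho>: "1 \<le> \<rho> G"
  shows "\<rho> G * (\<rho> G - 1) \<le> real (card (parcs G)) - 2 * real (card (pverts G)) + 2"
proof -
  interpret pair_graph G by fact
  let ?V = "pverts G"
  define d where "d v = real (card {w. (v, w) \<in> parcs G})" for v
  have d: "nbr_sum G (\<lambda>_. 1) v = d v" for v by (simp add: nbr_sum_one[OF G] d_def)
  have d2: "2 \<le> d v" if "v \<in> ?V" for v using deg[OF that] by (simp add: d_def)
  define C where "C = real (card (parcs G)) - 2 * real (card ?V) + 2"
  have "(\<Sum>v\<in>?V. card {w. (v, w) \<in> parcs G}) = card (parcs G)"
    by (rule sum_out_neighbours) (auto simp: pair_finite_verts dest: in_arcsD1 in_arcsD2)
  then have dsum: "sum d ?V = real (card (parcs G))"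
    unfolding d_def by (metis of_nat_sum)
  have nd: "nbr_sum G d v \<le> C + d v" if v: "v \<in> ?V" for v
  proof -
    have "(v, v) \<notin> parcs G" using no_loops'[of v v] by blast
    \<comment> \<open>The summand is d(w) at a neighbour, d(v) at \<open>v\<close> itself, and 2
      \<le> d(w) elsewhere.\<close>
    then have "(\<Sum>w\<in>?V. 2 - 2 * (if (v, w) \<in> parcs G then 1 else 0) + (if w = v then d v - 2 else 0)
        + (if (v, w) \<in> parcs G then d w else 0)) \<le> sum d ?V"
      using d2 by (intro sum_mono) auto
    moreover have "(\<Sum>w\<in>?V. if w = v then d v - 2 else 0) = d v - 2"
      using v by (simp add: pair_finite_verts)
    ultimately have
      "2 * real (card ?V) - 2 * nbr_sum G (\<lambda>_. 1) v + (d v - 2) + nbr_sum G d v \<le> sum d ?V"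
      by (simp only: sum.distrib sum_subtractf sum_distrib_left[symmetric] nbr_sum_def) simp
    then show ?thesis by (simp add: d C_def dsum)
  qed
  obtain y u where y: "\<And>v. 0 \<le> y v" and u: "u \<in> ?V" "0 < y u"
    and sub: "\<And>v. v \<in> ?V \<Longrightarrow> \<rho> G * y v \<le> nbr_sum G y v"
    using spectral_radius_subharmonic[OF G ne] by blast
  define S where "S = (\<Sum>v\<in>?V. d v * y v)"
  have P: "0 < sum y ?V" using u y by (intro sum_pos2[OF pair_finite_verts u(1)]) auto
  have S: "S = (\<Sum>v\<in>?V. nbr_sum G y v)"
    using nbr_sum_adjoint[OF G, of "\<lambda>_. 1" y] by (simp add: S_def d)
  have "\<rho> G * sum y ?V \<le> S"
    unfolding S sum_distrib_left using sub by (intro sum_mono) auto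
  \<comment> \<open>Multiplying by \<rho> - 1 \<ge> 0 allows \<open>S\<close> to be eliminated by
    the next inequality, (\<rho> - 1) S \<le> C (sum y).\<close>
  then have "(\<rho> G - 1) * (\<rho> G * sum y ?V) \<le> (\<rho> G - 1) * S" using \<rho> by (intro mult_left_mono) auto
  moreover have "\<rho> G * S \<le> C * sum y ?V + S"
  proof -
    have "\<rho> G * S = (\<Sum>v\<in>?V. d v * (\<rho> G * y v))" by (simp add: S_def sum_distrib_left mult_ac)
    also have "\<dots> \<le> (\<Sum>v\<in>?V. d v * nbr_sum G y v)"
      using sub by (intro sum_mono mult_left_mono) (auto simp: d_def)
    also have "\<dots> = (\<Sum>v\<in>?V. nbr_sum G d v * y v)" by (rule nbr_sum_adjoint[OF G])
    also have "\<dots> \<le> (\<Sum>v\<in>?V. (C + d v) * y v)" using nd y by (intro sum_mono mult_right_mono) auto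
    also have "\<dots> = C * sum y ?V + S"
      by (simp add: S_def algebra_simps sum.distrib sum_distrib_left)
    finally show ?thesis .
  qed
  ultimately have "\<rho> G * (\<rho> G - 1) * sum y ?V \<le> C * sum y ?V" by (simp add: algebra_simps)
  then show ?thesis using P by (simp add: C_def)
qed

section \<open>Joins of a clique with \<open>K\<^sub>2 \<union> K\<^sub>t\<close> or \<open>K\<^sub>2 \<union> t K\<^sub>1\<close>\<close>

text \<open>The parts of a join: the clique \<open>Hub\<close>, the edge \<open>Twin\<close>, and
  \<open>Rest\<close>, a clique or edgeless according to \<open>b\<close>. A colouring replaces an
  explicit embedding into the join.\<close>

datatype colour = Hub | Twin | Rest

fun compatible :: "bool \<Rightarrow> colour \<Rightarrow> colour \<Rightarrow> bool" where
  "compatible b Hub _ = True"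
| "compatible b _ Hub = True"
| "compatible b Twin Twin = True"
| "compatible b Rest Rest = b"
| "compatible b _ _ = False"

definition colour_arcs :: "bool \<Rightarrow> ('a \<Rightarrow> colour) \<Rightarrow> 'a set \<Rightarrow> 'a rel" where
  "colour_arcs b f V = {(v, w). v \<in> V \<and> w \<in> V \<and> v \<noteq> w \<and> compatible b (f v) (f w)}"

definition class_sizes :: "('a \<Rightarrow> colour) \<Rightarrow> 'a set \<Rightarrow> nat \<Rightarrow> nat \<Rightarrow> bool" where
  "class_sizes f V s t \<longleftrightarrow> finite V \<and> card {v \<in> V. f v = Hub} = s \<and>
     card {v \<in> V. f v = Twin} = 2 \<and> card {v \<in> V. f v = Rest} = t"

abbreviation cone_graph :: "bool \<Rightarrow> nat \<Rightarrow> nat \<Rightarrow> (nat + (nat + nat)) pair_pre_digraph" where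
  "cone_graph b s t \<equiv>
     complete_graph s \<or>\<^sub>g (complete_graph 2 \<union>\<^sub>g (if b then complete_graph t else edgeless_graph t))"

definition cone_colour :: "nat + (nat + nat) \<Rightarrow> colour" where
  "cone_colour = case_sum (\<lambda>_. Hub) (case_sum (\<lambda>_. Twin) (\<lambda>_. Rest))"

lemma pair_graph_cone: "pair_graph (cone_graph b s t)"
  by (simp add: pair_graph_join pair_graph_disjoint_union pair_graph_complete_graph
      pair_graph_edgeless_graph)

lemma pverts_cone: "pverts (cone_graph b s t) = {..<s} <+> ({..<2} <+> {..<t})"
  by (simp add: graph_join_def disjoint_union_def complete_graph_def edgeless_graph_def)

lemma parcs_cone: "parcs (cone_graph b s t) = colour_arcs b cone_colour (pverts (cone_graph b s t))"
proof -
  have map_prod_iff: "(x, y) \<in> map_prod f g ` A \<longleftrightarrow> (\<exists>a b. (a, b) \<in> A \<and> x = f a \<and> y = g b)"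
    for x y and A :: "('a \<times> 'b) set" and f :: "'a \<Rightarrow> 'c" and g :: "'b \<Rightarrow> 'd" by force
  have "\<forall>x y. (x, y) \<in> parcs (cone_graph b s t) \<longleftrightarrow>
      (x, y) \<in> colour_arcs b cone_colour (pverts (cone_graph b s t))"
    unfolding pverts_cone split_sum_all
    by (auto simp: graph_join_def disjoint_union_def complete_graph_def edgeless_graph_def
        colour_arcs_def cone_colour_def map_prod_iff)
  then show ?thesis by auto
qed

lemma class_sizes_cone: "class_sizes cone_colour (pverts (cone_graph b s t)) s t"
proof -
  have "{v \<in> pverts (cone_graph b s t). cone_colour v = Hub} = Inl ` {..<s}"
    "{v \<in> pverts (cone_graph b s t). cone_colour v = Twin} = (Inr \<circ> Inl) ` {..<2}"
    "{v \<in> pverts (cone_graph b s t). cone_colour v = Rest} = (Inr \<circ> Inr) ` {..<t}"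
    unfolding pverts_cone by (auto simp: cone_colour_def)
  then show ?thesis
    by (simp add: class_sizes_def pverts_cone card_image inj_on_def)
qed

text \<open>Adjacency depends on colours only, so bijections between equally large colour classes
  glue to an isomorphism.\<close>

lemma graph_iso_of_colouring:
  assumes G: "pair_graph G" and f: "class_sizes f (pverts G) s t" "parcs G = colour_arcs b f (pverts G)"
    and g: "class_sizes g (pverts H) s t" "parcs H = colour_arcs b g (pverts H)"
  shows "G \<cong>\<^sub>g H"
proof -
  interpret pair_graph G by fact
  have "\<exists>h. bij_betw h {v \<in> pverts G. f v = c} {w \<in> pverts H. g w = c}" for c
    using f(1) g(1) by (intro finite_same_card_bij; cases c) (auto simp: class_sizes_def)
  then obtain h where h: "\<And>c. bij_betw (h c) {v \<in> pverts G. f v = c} {w \<in> pverts H. g w = c}"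
    by metis
  define \<phi> where "\<phi> v = h (f v) v" for v
  have \<phi>: "\<phi> v \<in> pverts H" "g (\<phi> v) = f v" if "v \<in> pverts G" for v
    using h[of "f v"] that by (auto simp: \<phi>_def bij_betw_def)
  have inj: "inj_on \<phi> (pverts G)"
  proof (rule inj_onI)
    fix v w assume v: "v \<in> pverts G" and w: "w \<in> pverts G" and eq: "\<phi> v = \<phi> w"
    then have "f v = f w" using \<phi>(2) by metis
    then show "v = w"
      using eq v w h[of "f v"] by (auto simp: \<phi>_def bij_betw_def dest: inj_onD)
  qed
  have img: "\<phi> ` pverts G = pverts H"
  proof (intro equalityI subsetI)
    fix w assume "w \<in> pverts H"
    then have "w \<in> h (g w) ` {v \<in> pverts G. f v = g w}"
      using h[of "g w"] by (auto simp: bij_betw_def)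
    then obtain v where "v \<in> pverts G" "f v = g w" "w = h (g w) v" by blast
    then show "w \<in> \<phi> ` pverts G" by (intro image_eqI[of _ _ v]) (simp_all add: \<phi>_def)
  qed (use \<phi> in auto)
  have arcs: "map_prod \<phi> \<phi> ` parcs G = parcs H"
  proof (intro equalityI subsetI)
    fix e assume "e \<in> map_prod \<phi> \<phi> ` parcs G"
    then show "e \<in> parcs H"
      unfolding f(2) g(2) colour_arcs_def using \<phi> inj by (auto dest: inj_onD)
  next
    fix e assume "e \<in> parcs H"
    then obtain x y where e: "e = (x, y)" and xy: "x \<in> pverts H" "y \<in> pverts H" "x \<noteq> y"
        "compatible b (g x) (g y)"
      unfolding g(2) colour_arcs_def by auto
    obtain v w where "x = \<phi> v" "y = \<phi> w" "v \<in> pverts G" "w \<in> pverts G"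
      using xy unfolding img[symmetric] by blast
    then show "e \<in> map_prod \<phi> \<phi> ` parcs G"
      using xy \<phi> unfolding e f(2) colour_arcs_def by (intro image_eqI[of _ _ "(v, w)"]) auto
  qed
  have injA: "inj_on (map_prod \<phi> \<phi>) (parcs G)"
    by (rule inj_on_subset[OF map_prod_inj_on[OF inj inj]]) (auto dest: in_arcsD1 in_arcsD2)
  define hom where "hom = \<lparr>iso_verts = \<phi>, iso_arcs = map_prod \<phi> \<phi>, iso_head = snd, iso_tail = fst\<rparr>"
  have "wf_digraph (with_proj G)" by unfold_locales
  then have "pre_digraph.digraph_isomorphism (with_proj G) hom"
    using inj injA by (auto simp: pre_digraph.digraph_isomorphism_def hom_def)
  moreover have "with_proj H = app_iso hom (with_proj G)"
    by (simp add: app_iso_def hom_def img arcs with_proj_def)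
  ultimately show ?thesis unfolding digraph_iso_def by blast
qed

section \<open>Weights on the joins and the equation for their spectral radius\<close>

text \<open>A twin sees \<open>s\<close> hubs of weight 1 and one twin, so its weight solves x z = s
  + z; a rest vertex gives x z = s + (t - 1) z or x z = s according to \<open>b\<close>.\<close>

definition cone_weight :: "bool \<Rightarrow> nat \<Rightarrow> nat \<Rightarrow> real \<Rightarrow> colour \<Rightarrow> real" where
  "cone_weight b s t x c = (case c of Hub \<Rightarrow> 1 | Twin \<Rightarrow> s / (x - 1)
     | Rest \<Rightarrow> s / (x - (if b then real t - 1 else 0)))"

text \<open>The hub row of the eigenvalue equation at \<open>x\<close>; \<^const>\<open>cone_weight\<close> solves the other rows
  for every \<open>x\<close>.\<close>

definition cone_char :: "bool \<Rightarrow> nat \<Rightarrow> nat \<Rightarrow> real \<Rightarrow> real" where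
  "cone_char b s t x =
     real s - 1 + 2 * s / (x - 1) + t * s / (x - (if b then real t - 1 else 0))"

lemma sum_by_colour:
  fixes z :: "colour \<Rightarrow> real"
  assumes "class_sizes f V s t"
  shows "(\<Sum>v\<in>V. z (f v)) = s * z Hub + 2 * z Twin + t * z Rest"
proof -
  have "(\<Sum>v\<in>V. z (f v)) = (\<Sum>v\<in>V. (if f v = Hub then z Hub else 0)
      + (if f v = Twin then z Twin else 0) + (if f v = Rest then z Rest else 0))"
  proof (rule sum.cong)
    fix v show "z (f v) = (if f v = Hub then z Hub else 0)
      + (if f v = Twin then z Twin else 0) + (if f v = Rest then z Rest else 0)"
      by (cases "f v") auto
  qed simp
  also have "\<dots> = s * z Hub + 2 * z Twin + t * z Rest"
    using assms by (simp add: sum.distrib sum.If_cases class_sizes_def Int_def)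
  finally show ?thesis .
qed

lemma colour_arcs_row_sum:
  assumes V: "class_sizes f V s t" and v: "v \<in> V"
    and x: "x > 1" "b \<longrightarrow> x > real t - 1"
  shows "(\<Sum>w\<in>V. if (v, w) \<in> colour_arcs b f V then cone_weight b s t x (f w) else 0) =
    (if f v = Hub then cone_char b s t x else x * cone_weight b s t x (f v))" (is "?L = ?R")
proof -
  \<comment> \<open>Compatibility of equal colours would also count \<open>v\<close> itself; that
    term is subtracted.\<close>
  let ?z = "\<lambda>c. if compatible b (f v) c then cone_weight b s t x c else 0"
  have "?L = (\<Sum>w\<in>V. ?z (f w) - (if w = v then ?z (f v) else 0))"
    using v by (intro sum.cong) (auto simp: colour_arcs_def)
  also have "\<dots> = (\<Sum>w\<in>V. ?z (f w)) - ?z (f v)"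
    using v V by (simp add: sum_subtractf class_sizes_def)
  also have "\<dots> = s * ?z Hub + 2 * ?z Twin + t * ?z Rest - ?z (f v)"
    using sum_by_colour[OF V, of ?z] by simp
  also have "\<dots> = ?R"
  proof -
    have "x * (s / (x - 1)) = s + s / (x - 1)"
      "b \<Longrightarrow> x * (s / (x - (real t - 1))) = s + (real t - 1) * (s / (x - (real t - 1)))"
      "x * (s / x) = s"
      using x by (auto simp: divide_simps) (auto simp: algebra_simps)
    then show ?thesis
      by (cases "f v"; cases b) (simp_all add: cone_weight_def cone_char_def algebra_simps diff_divide_distrib)
  qed
  finally show ?thesis .
qed

lemma cone_weight_pos:
  assumes "s \<ge> 1" "x > 1" "b \<longrightarrow> x > real t - 1"
  shows "0 < cone_weight b s t x c"
  using assms by (cases c) (auto simp: cone_weight_def)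

text \<open>Deleting arcs lowers the row sums of a positive weight, strictly in a row that loses an
  arc; \<open>cone_char b s t x \<le> x\<close> settles the hub rows.\<close>

lemma nbr_sum_colour_le:
  assumes V: "class_sizes f (pverts G) s t" and sub: "parcs G \<subseteq> colour_arcs b f (pverts G)"
    and s: "s \<ge> 1" and x: "x > 1" "b \<longrightarrow> x > real t - 1" "cone_char b s t x \<le> x"
    and v: "v \<in> pverts G"
  shows "nbr_sum G (\<lambda>v. cone_weight b s t x (f v)) v \<le> x * cone_weight b s t x (f v)"
    and "(v, w) \<in> colour_arcs b f (pverts G) - parcs G \<Longrightarrow>
      nbr_sum G (\<lambda>v. cone_weight b s t x (f v)) v < x * cone_weight b s t x (f v)"
proof -
  let ?V = "pverts G" and ?z = "\<lambda>v. cone_weight b s t x (f v)"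
  let ?S = "\<Sum>w\<in>?V. if (v, w) \<in> colour_arcs b f ?V then ?z w else 0"
  have z: "0 < ?z w" for w by (rule cone_weight_pos[OF s x(1,2)])
  have "?S = (if f v = Hub then cone_char b s t x else x * ?z v)"
    by (rule colour_arcs_row_sum[OF V v x(1,2)])
  then have S: "?S \<le> x * ?z v" using x(3) by (auto simp: cone_weight_def)
  have le: "(if (v, w) \<in> parcs G then ?z w else 0) \<le> (if (v, w) \<in> colour_arcs b f ?V then ?z w else 0)"
    for w using sub z[of w] by auto
  show "nbr_sum G ?z v \<le> x * ?z v"
  proof -
    have "nbr_sum G ?z v \<le> ?S" unfolding nbr_sum_def by (intro sum_mono le)
    then show ?thesis using S by linarith
  qed
  assume w: "(v, w) \<in> colour_arcs b f ?V - parcs G"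
  then have "w \<in> ?V" by (auto simp: colour_arcs_def)
  then have "nbr_sum G ?z v < ?S"
    unfolding nbr_sum_def using V le w z[of w]
    by (intro sum_strict_mono_ex1) (auto simp: class_sizes_def)
  then show "nbr_sum G ?z v < x * ?z v" using S by simp
qed

lemma spectral_radius_le_cone:
  assumes "pair_graph G" "pverts G \<noteq> {}" "class_sizes f (pverts G) s t"
    "parcs G \<subseteq> colour_arcs b f (pverts G)" "s \<ge> 1"
    "x > 1" "b \<longrightarrow> x > real t - 1" "cone_char b s t x \<le> x"
  shows "\<rho> G \<le> x"
  using assms(1,2) cone_weight_pos[OF assms(5-7)] nbr_sum_colour_le(1)[OF assms(3-8)]
  by (rule spectral_radius_le_of_superharmonic)

lemma spectral_radius_less_cone:
  assumes "pair_graph G" "Digraph_Component.connected (with_proj G)"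
    "class_sizes f (pverts G) s t" "parcs G \<subset> colour_arcs b f (pverts G)" "s \<ge> 1"
    "x > 1" "b \<longrightarrow> x > real t - 1" "cone_char b s t x \<le> x"
  shows "\<rho> G < x"
proof -
  obtain v w where vw: "(v, w) \<in> colour_arcs b f (pverts G) - parcs G" using assms(4) by auto
  then have v: "v \<in> pverts G" by (auto simp: colour_arcs_def)
  note le = nbr_sum_colour_le[OF assms(3) psubset_imp_subset[OF assms(4)] assms(5-8)]
  show ?thesis
    by (rule spectral_radius_less_of_superharmonic[OF assms(1,2) cone_weight_pos[OF assms(5-7)]
          le(1) v le(2)[OF v vw]])
qed

text \<open>The poles of \<open>cone_char\<close> lie left of \<open>x\<close>, so the intermediate
  value theorem gives a root; there the hub row holds as well and the weights form an
  eigenvector.\<close>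

lemma cone_eigenvalue:
  assumes s: "s \<ge> 1" and x: "x > 1" "b \<longrightarrow> x > real t - 1" "cone_char b s t x > x"
    and y: "y > x" "cone_char b s t y < y"
  obtains r where "r > x" "cone_char b s t r = r" "r \<le> \<rho> (cone_graph b s t)"
proof -
  have ne: "u - 1 \<noteq> 0" "b \<Longrightarrow> u - (real t - 1) \<noteq> 0" "u \<noteq> 0" if "u \<ge> x" for u
    using that x by auto
  have "continuous_on {x..y} (\<lambda>u. cone_char b s t u - u)"
    unfolding cone_char_def using ne x by (cases b) (auto intro!: continuous_intros)
  then obtain r where l: "x \<le> r" "r \<le> y" "cone_char b s t r - r = 0"
    using IVT2'[of "\<lambda>u. cone_char b s t u - u" y 0 x] x y by auto
  then have "r \<noteq> x" using x(3) by auto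
  then have lx: "r > x" using l by simp
  let ?G = "cone_graph b s t"
  let ?z = "\<lambda>v. cone_weight b s t r (cone_colour v)"
  have l1: "r > 1" "b \<longrightarrow> r > real t - 1" using lx x by auto
  have eig: "nbr_sum ?G ?z v = r * ?z v" if "v \<in> pverts ?G" for v
    using colour_arcs_row_sum[OF class_sizes_cone that l1] l(3)
    unfolding nbr_sum_def parcs_cone by (auto simp: cone_weight_def)
  have "Inl 0 \<in> pverts ?G" using s unfolding pverts_cone by auto
  moreover have "?z (Inl 0) \<noteq> 0" by (simp add: cone_weight_def cone_colour_def)
  ultimately have "r \<le> \<rho> ?G"
    by (rule eigenvalue_le_spectral_radius[OF pair_graph_cone _ _ eig])
  then show thesis using that lx l(3) by simp
qed

section \<open>Graphs that are not 1-excludable\<close>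

lemma perfect_matching_of_involutive_matching:
  assumes G: "pair_graph G" and f: "involutive_matching (pverts G) E f" and E: "E \<subseteq> parcs G"
  shows "perfect_matching G ((\<lambda>v. {v, f v}) ` pverts G)"
  unfolding perfect_matching_def
proof (intro conjI ballI)
  show "(\<lambda>v. {v, f v}) ` pverts G \<subseteq> uedges G"
    using f E by (auto simp: involutive_matching_def uedges_def)
  fix v assume v: "v \<in> pverts G"
  have "e = {v, f v}" if e: "e \<in> (\<lambda>v. {v, f v}) ` pverts G" "v \<in> e" for e
  proof -
    obtain w where "w \<in> pverts G" "e = {w, f w}" using e(1) by blast
    then show ?thesis using e(2) f by (auto simp: involutive_matching_def)
  qed
  then show "\<exists>!e. e \<in> (\<lambda>v. {v, f v}) ` pverts G \<and> v \<in> e"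
    using v by (intro ex1I[of _ "{v, f v}"]) auto
qed

text \<open>Both arcs of an edge lying in every perfect matching are deleted; a matching of the rest
  would avoid that edge.\<close>

lemma not_one_excludableE:
  assumes G: "pair_graph G" and not: "\<not> one_excludable G"
  obtains p q where "(p, q) \<in> parcs G"
    "\<nexists>f. involutive_matching (pverts G) (parcs G - {(p, q), (q, p)}) f"
proof -
  obtain e where e: "e \<in> uedges G" and ne: "\<And>M. perfect_matching G M \<Longrightarrow> e \<in> M"
    using not by (auto simp: one_excludable_def)
  obtain p q where pq: "e = {p, q}" "(p, q) \<in> parcs G" using e by (auto simp: uedges_def)
  have "\<not> involutive_matching (pverts G) (parcs G - {(p, q), (q, p)}) f" for f
  proof
    assume f: "involutive_matching (pverts G) (parcs G - {(p, q), (q, p)}) f"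
    have "e \<in> (\<lambda>v. {v, f v}) ` pverts G"
      by (rule ne[OF perfect_matching_of_involutive_matching[OF G f]]) blast
    then obtain v where "v \<in> pverts G" "{p, q} = {v, f v}" using pq by blast
    then show False using f by (auto simp: involutive_matching_def doubleton_eq_iff)
  qed
  then show thesis using that pq by blast
qed

lemma out_degree_with_proj:
  "out_degree (with_proj G) v = card {w. (v, w) \<in> parcs G}"
proof -
  have "out_arcs (with_proj G) v = Pair v ` {w. (v, w) \<in> parcs G}"
    by (auto simp: out_arcs_def)
  then show ?thesis by (simp add: out_degree_def card_image inj_on_def)
qed

text \<open>The edge bound leaves few missing edges after deletion of \<open>pq\<close>, so
  \<open>dense_unmatchable_cases\<close> applies; restoring \<open>pq\<close> turns its outcomes
  into coloured joins.\<close>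

lemma not_excludable_structure:
  assumes G: "pair_graph G" and card: "card (pverts G) = 2 * k" and k: "k \<ge> 3"
    and degree: "\<forall>v\<in>pverts G. 2 \<le> card {w. (v, w) \<in> parcs G}"
    and \<rho>: "\<rho> G > 2 * real k - 3" and not: "\<not> one_excludable G"
  obtains
    (hub) f where "class_sizes f (pverts G) 1 (2 * k - 3)"
      "parcs G = colour_arcs True f (pverts G)"
  | (independent) f where "k \<le> 5" "class_sizes f (pverts G) (k - 1) (k - 1)"
      "parcs G \<subseteq> colour_arcs False f (pverts G)"
proof -
  interpret pair_graph G by fact
  let ?V = "pverts G" and ?P = "parcs G"
  have fin: "finite ?V" by (rule pair_finite_verts)
  have P: "simple_arcs ?V ?P"
    using pair_sym_arcs by (auto simp: simple_arcs_def symmetric_def irrefl_def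
        dest: in_arcsD1 in_arcsD2 no_loops')
  obtain p q where pq: "(p, q) \<in> ?P"
    and none: "\<nexists>f. involutive_matching ?V (?P - {(p, q), (q, p)}) f"
    using not_one_excludableE[OF G not] by blast
  define H where "H = ?P - {(p, q), (q, p)}"
  have pqne: "p \<noteq> q" and qp: "(q, p) \<in> ?P"
    using P pq by (auto simp: simple_arcs_def irrefl_def dest: symD)
  have H: "simple_arcs ?V H" using P by (auto simp: H_def simple_arcs_def sym_def irrefl_def)
  have finP: "finite ?P" by (rule pair_finite_arcs)
  have cH: "card ?P = card H + 2"
    using pq qp pqne finP card_Diff_subset[of "{(p, q), (q, p)}" ?P]
      card_mono[of ?P "{(p, q), (q, p)}"] by (simp add: H_def)
  note deg = bspec[OF degree]
  have V0: "?V \<noteq> {}" using card k by auto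
  have "\<rho> G * (\<rho> G - 1) \<le> real (card ?P) - 2 * real (2 * k) + 2"
    using spectral_radius_edge_bound[OF G V0 deg] \<rho> k card by simp
  \<comment> \<open>This yields more than 4 k^2 - 10 k + 10 arcs, hence by parity at least 4 k^2 -
    10 k + 12, of which \<open>H\<close> loses two.\<close>
  moreover have "(2 * real k - 3) * (2 * real k - 4) < \<rho> G * (\<rho> G - 1)"
    using \<rho> k by (intro mult_strict_mono) auto
  ultimately have "4 * real k * real k - 10 * real k + 10 < real (card ?P)"
    by (simp add: algebra_simps)
  then have "real (4 * k * k + 10) < real (card ?P + 10 * k)" by simp
  then have "4 * k * k + 10 < card ?P + 10 * k" by (simp only: of_nat_less_iff)
  moreover have "even (card ?P)"
    using P finP by (intro even_card_symmetric) (auto simp: simple_arcs_def)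
  moreover obtain l where "4 * k * k = 4 * l" by (metis mult.assoc)
  ultimately have cP: "4 * k * k + 12 \<le> card ?P + 10 * k" by presburger
  have degH: "card {w. (v, w) \<in> ?P} \<le> card {w. (v, w) \<in> H} + 1" if v: "v \<in> ?V" for v
  proof -
    have "{w. (v, w) \<in> ?P} \<subseteq> insert (if v = p then q else p) {w. (v, w) \<in> H}"
      using pqne by (auto simp: H_def)
    moreover have "finite {w. (v, w) \<in> H}"
      using H by (intro finite_subset[OF _ fin]) (auto simp: simple_arcs_def)
    ultimately show ?thesis
      using card_mono[OF _ \<open>{w. (v, w) \<in> ?P} \<subseteq> _\<close>] card_insert_le_m1
      by (metis Suc_eq_plus1 card_insert_if finite_insert le_SucI)
  qed
  have miss: "card {w. (v, w) \<in> H} + card (missing ?V H v) + 1 = 2 * k" if "v \<in> ?V" for v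
    using card_neighbours_missing[OF fin H that] card by simp
  have "(\<Sum>v\<in>?V. card {w. (v, w) \<in> H} + card (missing ?V H v) + 1) = 2 * k * (2 * k)"
    using miss card by simp
  moreover have "(\<Sum>v\<in>?V. card {w. (v, w) \<in> H}) = card H"
    using H by (intro sum_out_neighbours fin) (simp add: simple_arcs_def)
  ultimately have "card H + (\<Sum>v\<in>?V. card (missing ?V H v)) + 2 * k = 4 * k * k"
    using card unfolding sum.distrib by simp
  then have total: "(\<Sum>v\<in>?V. card (missing ?V H v)) \<le> 8 * k - 10"
    using cP cH by linarith
  have mdeg: "\<forall>v\<in>?V. card (missing ?V H v) \<le> 2 * k - 2"
  proof
    fix v assume v: "v \<in> ?V"
    show "card (missing ?V H v) \<le> 2 * k - 2"
      using miss[OF v] degH[OF v] deg[OF v] by linarith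
  qed
  show thesis
  proof (cases rule: dense_unmatchable_cases[OF fin card k H none[folded H_def] mdeg total])
    case (1 a b c)
    \<comment> \<open>In \<open>H\<close> the vertices \<open>a\<close>, \<open>b\<close> see only
      \<open>c\<close>, but in \<open>G\<close> their degrees are at least 2; so they are the ends
      of the deleted edge.\<close>
    have other: "\<exists>w. w \<noteq> c \<and> (x, w) \<in> ?P" if x: "x \<in> ?V" for x
    proof (rule ccontr)
      assume "\<nexists>w. w \<noteq> c \<and> (x, w) \<in> ?P"
      then have "{w. (x, w) \<in> ?P} \<subseteq> {c}" by blast
      then have "card {w. (x, w) \<in> ?P} \<le> 1" using card_mono[of "{c}"] by fastforce
      then show False using deg[OF x] by simp
    qed
    have "a \<in> {p, q}" "b \<in> {p, q}"
      using other[OF 1(1)] other[OF 1(2)] 1(4-7) by (auto simp: H_def set_eq_iff)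
    then have ab: "{(p, q), (q, p)} = {(a, b), (b, a)}" using 1(4) pqne by auto
    define f where "f v = (if v = c then Hub else if v \<in> {a, b} then Twin else Rest)" for v
    have "{v \<in> ?V. f v = Hub} = {c}" "{v \<in> ?V. f v = Twin} = {a, b}"
      "{v \<in> ?V. f v = Rest} = ?V - {a, b, c}"
      using 1(1-6) by (auto simp: f_def)
    moreover have "card (?V - {a, b, c}) = 2 * k - 3"
      using 1(1-6) card by (simp add: card_Diff_subset)
    ultimately have "class_sizes f ?V 1 (2 * k - 3)"
      using 1(4) fin by (simp add: class_sizes_def)
    moreover have "?P = colour_arcs True f ?V"
    proof -
      have "?P = H \<union> {(a, b), (b, a)}" using pq qp ab by (auto simp: H_def)
      also have "\<dots> = colour_arcs True f ?V"
        unfolding 1(7) colour_arcs_def using 1(1-6) by (auto simp: f_def)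
      finally show ?thesis .
    qed
    ultimately show thesis by (rule that(1))
  next
    case (2 W)
    \<comment> \<open>Only the deleted edge can lie inside \<open>W\<close>. Its ends become the
      twins; if it is not inside \<open>W\<close>, any two elements of \<open>W\<close>
      serve.\<close>
    have "\<exists>a b. a \<in> W \<and> b \<in> W \<and> a \<noteq> b \<and> ?P \<inter> W \<times> W \<subseteq> {(a, b), (b, a)}"
    proof (cases "p \<in> W \<and> q \<in> W")
      case True
      then show ?thesis using 2(4) pqne by (intro exI[of _ p] exI[of _ q]) (auto simp: H_def)
    next
      case False
      have "\<exists>a b. a \<in> W \<and> b \<in> W \<and> a \<noteq> b"
        using 2(3) k card_le_Suc0_iff_eq[of W] finite_subset[OF 2(2) fin] by auto
      then show ?thesis using False 2(4) by (auto simp: H_def)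
    qed
    then obtain a b where ab: "a \<in> W" "b \<in> W" "a \<noteq> b" "?P \<inter> W \<times> W \<subseteq> {(a, b), (b, a)}" by blast
    define f where "f v = (if v \<notin> W then Hub else if v \<in> {a, b} then Twin else Rest)" for v
    have finW: "finite W" by (rule finite_subset[OF 2(2) fin])
    have "{v \<in> ?V. f v = Hub} = ?V - W" "{v \<in> ?V. f v = Twin} = {a, b}"
      "{v \<in> ?V. f v = Rest} = W - {a, b}"
      using 2(2) ab by (auto simp: f_def)
    moreover have "card (?V - W) = k - 1" "card (W - {a, b}) = k - 1"
      using 2(2,3) ab card finW by (simp_all add: card_Diff_subset)
    ultimately have "class_sizes f ?V (k - 1) (k - 1)"
      using ab fin by (simp add: class_sizes_def)
    moreover have "?P \<subseteq> colour_arcs False f ?V"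
    proof (rule subrelI)
      fix v w assume vw: "(v, w) \<in> ?P"
      then have "v \<in> ?V" "w \<in> ?V" "v \<noteq> w" using P by (auto simp: simple_arcs_def irrefl_def)
      moreover have "(v, w) \<in> {(a, b), (b, a)} \<or> v \<notin> W \<or> w \<notin> W" using vw ab(4) by blast
      then have "compatible False (f v) (f w)"
        using ab(1-3) by (cases "f v"; cases "f w") (auto simp: f_def split: if_splits)
      ultimately show "(v, w) \<in> colour_arcs False f ?V" by (simp add: colour_arcs_def)
    qed
    ultimately show thesis using that(2) 2(1) by blast
  qed
qed

section \<open>Comparison with the extremal graphs\<close>

theorem theorem1p6:
  fixes n :: nat and G :: "'a pair_pre_digraph"
  assumes "even n" and "n > 0"
    and "pair_graph G" and "card (pverts G) = n"
    and "Digraph_Component.connected (with_proj G)"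
    and "min_degree G \<ge> 2"
  shows
    "(n = 6 \<and> \<rho> G \<ge> \<rho> (complete_graph 2 \<or>\<^sub>g (complete_graph 2 \<union>\<^sub>g edgeless_graph 2))
       \<longrightarrow> \<not> G \<cong>\<^sub>g complete_graph 2 \<or>\<^sub>g (complete_graph 2 \<union>\<^sub>g edgeless_graph 2)
       \<longrightarrow> one_excludable G)
   \<and> (n = 8 \<and> \<rho> G \<ge> \<rho> (complete_graph 3 \<or>\<^sub>g (complete_graph 2 \<union>\<^sub>g edgeless_graph 3))
       \<longrightarrow> \<not> G \<cong>\<^sub>g complete_graph 3 \<or>\<^sub>g (complete_graph 2 \<union>\<^sub>g edgeless_graph 3)
       \<longrightarrow> one_excludable G)
   \<and> (n \<ge> 10 \<and> \<rho> G \<ge> \<rho> (complete_graph 1 \<or>\<^sub>g (complete_graph 2 \<union>\<^sub>g complete_graph (n - 3)))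
       \<longrightarrow> \<not> G \<cong>\<^sub>g complete_graph 1 \<or>\<^sub>g (complete_graph 2 \<union>\<^sub>g complete_graph (n - 3))
       \<longrightarrow> one_excludable G)"
proof -
  note G = assms(3) and conn = assms(5)
  interpret pair_graph G by fact
  have deg: "\<forall>v\<in>pverts G. 2 \<le> card {w. (v, w) \<in> parcs G}"
  proof
    fix v assume "v \<in> pverts G"
    then have "min_degree G \<le> out_degree (with_proj G) v"
      unfolding min_degree_def by (intro Min_le) (auto simp: pair_finite_verts)
    then show "2 \<le> card {w. (v, w) \<in> parcs G}"
      using assms(6) by (simp add: out_degree_with_proj)
  qed
  have ne: "pverts G \<noteq> {}" using assms(2,4) by auto
  obtain k where n: "n = 2 * k" using assms(1) by blast
  \<comment> \<open>The number \<open>x\<close> separates the candidates: it bounds the radius of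
    the \<open>hub\<close> join from above and lies below the root \<open>r\<close> of the other
    join. The value 10 only closes the bracket around \<open>r\<close>.\<close>
  have small: "one_excludable G \<or> G \<cong>\<^sub>g cone_graph False (k - 1) (k - 1)"
    if k: "k \<ge> 3" and ge: "\<rho> (cone_graph False (k - 1) (k - 1)) \<le> \<rho> G"
      and x: "x > 2 * real k - 3" "x < 10" "cone_char False (k - 1) (k - 1) x > x"
        "cone_char False (k - 1) (k - 1) 10 < 10" "cone_char True 1 (2 * k - 3) x \<le> x" for x :: real
  proof -
    have k1: "k - 1 \<ge> 1" using k by linarith
    obtain r where r: "r > x" "cone_char False (k - 1) (k - 1) r = r"
        "r \<le> \<rho> (cone_graph False (k - 1) (k - 1))"
      by (rule cone_eigenvalue[of "k - 1" x False "k - 1" 10]) (use k1 k x in auto)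
    show ?thesis
    proof (cases "one_excludable G")
      case False
      have \<rho>: "\<rho> G > 2 * real k - 3" using r ge x by linarith
      show ?thesis
      proof (cases rule: not_excludable_structure[OF G assms(4)[unfolded n] k deg \<rho> False])
        case (1 f)
        have "\<rho> G \<le> x"
          using x k by (intro spectral_radius_le_cone[OF G ne 1(1), of True]) (auto simp: 1(2)[symmetric])
        then show ?thesis using r ge by linarith
      next
        case (2 f)
        \<comment> \<open>A proper subgraph of the join would have radius below \<open>r\<close>,
          but \<open>r \<le> \<rho> G\<close>.\<close>
        have "\<not> parcs G \<subset> colour_arcs False f (pverts G)"
        proof
          assume "parcs G \<subset> colour_arcs False f (pverts G)"
          then have "\<rho> G < r"
            by (rule spectral_radius_less_cone[OF G conn 2(2)]) (use k1 r x k in auto)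
          then show False using r ge by linarith
        qed
        then have "parcs G = colour_arcs False f (pverts G)" using 2(3) by blast
        then show ?thesis
          using graph_iso_of_colouring[OF G 2(2) _ class_sizes_cone parcs_cone] by blast
      qed
    qed simp
  qed
  have six: "one_excludable G \<or> G \<cong>\<^sub>g cone_graph False 2 2"
    if "k = 3" "\<rho> (cone_graph False 2 2) \<le> \<rho> G"
    \<comment> \<open>3.3 separates the spectral radii of \<open>K\<^sub>1 \<or> (K\<^sub>2 \<union> K\<^sub>3)\<close> and \<open>K\<^sub>2 \<or> (K\<^sub>2 \<union> 2K\<^sub>1)\<close>;
      5.1 plays the same role for \<open>n = 8\<close>.\<close>
    using small[of "33 / 10"] that by (simp add: cone_char_def)
  have eight: "one_excludable G \<or> G \<cong>\<^sub>g cone_graph False 3 3"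
    if "k = 4" "\<rho> (cone_graph False 3 3) \<le> \<rho> G"
    using small[of "51 / 10"] that by (simp add: cone_char_def)
  have large: "one_excludable G \<or> G \<cong>\<^sub>g cone_graph True 1 (2 * k - 3)"
    if k: "k \<ge> 5" and ge: "\<rho> (cone_graph True 1 (2 * k - 3)) \<le> \<rho> G"
  proof (cases "one_excludable G")
    case False
    have k3: "k \<ge> 3" using k by simp
    have "5 * 5 \<le> real k * real k" using k by (intro mult_mono) auto
    then have kk: "11 < real k * (real k * 12)" by simp
    let ?c = "cone_char True 1 (2 * k - 3)"
    \<comment> \<open>The bracket starts at n - 3, the spectral radius of the clique formed by the
      hub and the rest; \<open>kk\<close> settles the quadratic left after clearing
      denominators.\<close>
    have "?c (2 * k - 3) > 2 * real k - 3" "?c (2 * k) < 2 * real k"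
      using k kk by (auto simp: cone_char_def of_nat_diff field_simps)
    then obtain r where "r > 2 * real k - 3" "r \<le> \<rho> (cone_graph True 1 (2 * k - 3))"
      using cone_eigenvalue[of 1 "2 * real k - 3" True "2 * k - 3" "2 * real k"] k
      by (auto simp: of_nat_diff)
    then have \<rho>: "\<rho> G > 2 * real k - 3" using ge by linarith
    show ?thesis
    proof (cases rule: not_excludable_structure[OF G assms(4)[unfolded n] k3 deg \<rho> False])
      case (1 f)
      then show ?thesis
        using graph_iso_of_colouring[OF G 1 class_sizes_cone parcs_cone] by blast
    next
      case (2 f)
      \<comment> \<open>Only n = 10 remains, where the weights at 7 = n - 3 give \<rho> \<le> 7
        against \<rho> > 7.\<close>
      then have k5: "k = 5" using k by simp
      have "\<rho> G \<le> 7"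
        using spectral_radius_le_cone[OF G ne 2(2,3), of 7] k5 by (simp add: cone_char_def)
      then show ?thesis using \<rho> k5 by simp
    qed
  qed simp
  have "n \<ge> 10 \<longleftrightarrow> k \<ge> 5" "n = 6 \<longleftrightarrow> k = 3" "n = 8 \<longleftrightarrow> k = 4" using n by auto
  then show ?thesis using six eight large n by auto
qed

end
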